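(* Let $H$ be a separable Hilbert space and $V$ a separable Banach space. For every cylindrical probability measure $\theta$ on $\mathcal{Z}(H)$ and each $p\ge 1$, the space $\mathcal{R}^p(\theta)=\mathcal{R}^p_{H,V}(\theta)$ of operators from $H$ to $V$ that are $\theta$-radonifying of order $p$, equipped with the norm $\|\cdot\|_{\mathcal{R}^p}$, is a Banach space.
   Context: All spaces are real. For a separable Banach space $V$ with dual $V^*$ and dual pairing $\langle\cdot,\cdot\rangle$, and $v_1^*,\dots,v_n^*\in V^*$, let $\pi_{v_1^*,\dots,v_n^*}\colon V\to\mathbb{R}^n$, $v\mapsto(\langle v,v_1^*\rangle,\dots,\langle v,v_n^*\rangle)$. For $D\subseteq V^*$ let $\mathcal{Z}(V,D)$ be the algebra of all cylindrical sets $\pi_{v_1^*,\dots,v_n^*}^{-1}(B)$ with $n\in\mathbb{N}$, $v_i^*\in D$, $B\in\mathcal{B}(\mathbb{R}^n)$; let $\mathcal{C}(V,D)$ be the $\sigma$-algebra it generates, and $\mathcal{Z}(V):=\mathcal{Z}(V,V^* )$. A cylindrical probability measure on $\mathcal{Z}(V)$ is a function $\eta\colon\mathcal{Z}(V)\to[0,\infty]$ with $\eta(V)=1$ whose restriction to $\mathcal{C}(V,D)$ is a measure for each finite $D\subseteq V^*$. Its characteristic function is $\varphi_\eta(v^* )=\int_V e^{i\langle v,v^*\rangle}\,\eta(dv)$, $v^*\in V^*$; it is assumed throughout that characteristic functions of cylindrical measures are continuous. The same definitions apply to a separable Hilbert space $H$. $\mathcal{L}(H,V)$ denotes the bounded linear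 operators from $H$ to $V$ with operator norm $\|\cdot\|_{H\to V}$. For $T\in\mathcal{L}(H,V)$ the image cylindrical measure is $(\theta\circ T^{-1})(C)=\theta(T^{-1}(C))$, $C\in\mathcal{Z}(V)$. $T$ is called $\theta$-radonifying if $\theta\circ T^{-1}$ extends to a probability measure on the Borel $\sigma$-algebra $\mathcal{B}(V)$ (the extension is again denoted $\theta\circ T^{-1}$), and $\theta$-radonifying of order $p$ if in addition $\int_V\|v\|^p\,(\theta\circ T^{-1})(dv)<\infty$. $\mathcal{R}^p(\theta)=\mathcal{R}^p_{H,V}(\theta)$ is the linear space of all $T\in\mathcal{L}(H,V)$ that are $\theta$-radonifying of order $p$. For $T\in\mathcal{R}^p(\theta)$ set $$\|T\|_p:=\Big(\int_V\|v\|^p\,(\theta\circ T^{-1})(dv)\Big)^{1/p},\qquad \|T\|_{\mathcal{R}^p}:=\|T\|_p+\|T\|_{H\to V}.$$ *)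

theory Defs
  imports "HOL-Analysis.Analysis" "HOL-Probability.Probability"
begin

text \<open>
  A separable Banach space is a type of sort \<open>{banach, second_countable_topology}\<close>; for metric
  spaces second countability is separability.  The dual space of \<open>'v\<close> is \<open>'v \<Rightarrow>\<^sub>L real\<close>.
\<close>

text \<open>
  Since \<open>n\<close> varies, a point of Euclidean \<open>n\<close>-space is a function on \<open>{..<n}\<close>, extended by
  \<open>undefined\<close>.
\<close>

definition cyl_proj ::
    "nat \<Rightarrow> (nat \<Rightarrow> 'v::real_normed_vector \<Rightarrow>\<^sub>L real) \<Rightarrow> 'v \<Rightarrow> (nat \<Rightarrow> real)" where
  "cyl_proj n vs v = (\<lambda>i\<in>{..<n}. blinfun_apply (vs i) v)"

text \<open>
  The finite product of Borel \<open>\<sigma>\<close>-algebras of the reals is the Borel \<open>\<sigma>\<close>-algebra of the product.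
  The case \<open>n = 0\<close> contributes only the empty set and the whole space; it makes \<open>cyl_sets {}\<close>
  the trivial algebra.
\<close>

definition cyl_sets :: "('v::real_normed_vector \<Rightarrow>\<^sub>L real) set \<Rightarrow> 'v set set" where
  "cyl_sets D = {cyl_proj n vs -` B | n vs B.
     (\<forall>i<n. vs i \<in> D) \<and> B \<in> sets (Pi\<^sub>M {..<n} (\<lambda>_. borel :: real measure))}"

definition cyl_sigma :: "('v::real_normed_vector \<Rightarrow>\<^sub>L real) set \<Rightarrow> 'v set set" where
  "cyl_sigma D = sigma_sets UNIV (cyl_sets D)"

text \<open>
  A cylindrical measure is a set function on \<open>cyl_sets UNIV\<close>; its values on other sets are
  irrelevant.
\<close>

definition cylindrical_prob :: "('v::real_normed_vector set \<Rightarrow> ennreal) \<Rightarrow> bool" where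
  "cylindrical_prob \<eta> \<longleftrightarrow>
     \<eta> UNIV = 1 \<and> (\<forall>D. finite D \<longrightarrow> measure_space UNIV (cyl_sigma D) \<eta>)"

text \<open>
  The integrand depends on \<open>v\<close> only through the functional \<open>w\<close>, so the integral is taken with
  respect to the restriction of \<open>\<eta>\<close> to \<open>cyl_sigma {w}\<close>, which is a measure.
\<close>

definition cyl_char :: "('v::real_normed_vector set \<Rightarrow> ennreal) \<Rightarrow> ('v \<Rightarrow>\<^sub>L real) \<Rightarrow> complex" where
  "cyl_char \<eta> w =
     (LINT v | measure_of UNIV (cyl_sigma {w}) \<eta>. exp (\<i> * complex_of_real (blinfun_apply w v)))"

definition cyl_image ::
    "('h::real_normed_vector set \<Rightarrow> ennreal) \<Rightarrow> ('h \<Rightarrow>\<^sub>L 'v::real_normed_vector)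
      \<Rightarrow> 'v set \<Rightarrow> ennreal" where
  "cyl_image \<theta> T C = \<theta> (blinfun_apply T -` C)"

definition borel_extension ::
    "('v::real_normed_vector set \<Rightarrow> ennreal) \<Rightarrow> 'v measure \<Rightarrow> bool" where
  "borel_extension \<eta> \<mu> \<longleftrightarrow>
     prob_space \<mu> \<and> sets \<mu> = sets borel \<and> (\<forall>C\<in>cyl_sets UNIV. emeasure \<mu> C = \<eta> C)"

definition radonifying ::
    "('h::real_normed_vector set \<Rightarrow> ennreal) \<Rightarrow> ('h \<Rightarrow>\<^sub>L 'v::real_normed_vector) \<Rightarrow> bool" where
  "radonifying \<theta> T \<longleftrightarrow> (\<exists>\<mu>. borel_extension (cyl_image \<theta> T) \<mu>)"

text \<open>
  On a separable Banach space the extension is unique, because the cylindrical sets are closed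
  under intersection and generate the Borel \<open>\<sigma>\<close>-algebra.
\<close>

definition image_law ::
    "('h::real_normed_vector set \<Rightarrow> ennreal) \<Rightarrow> ('h \<Rightarrow>\<^sub>L 'v::real_normed_vector)
      \<Rightarrow> 'v measure" where
  "image_law \<theta> T = (THE \<mu>. borel_extension (cyl_image \<theta> T) \<mu>)"

definition radonifying_space ::
    "('h::real_normed_vector set \<Rightarrow> ennreal) \<Rightarrow> real
      \<Rightarrow> ('h \<Rightarrow>\<^sub>L 'v::real_normed_vector) set" where
  "radonifying_space \<theta> p =
     {T. radonifying \<theta> T \<and> (\<integral>\<^sup>+ v. ennreal (norm v powr p) \<partial>image_law \<theta> T) < \<infinity>}"

definition radonifying_norm ::
    "('h::real_normed_vector set \<Rightarrow> ennreal) \<Rightarrow> real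
      \<Rightarrow> ('h \<Rightarrow>\<^sub>L 'v::real_normed_vector) \<Rightarrow> real" where
  "radonifying_norm \<theta> p T =
     (LINT v | image_law \<theta> T. norm v powr p) powr (1 / p) + norm T"

definition norm_on :: "'a::real_vector set \<Rightarrow> ('a \<Rightarrow> real) \<Rightarrow> bool" where
  "norm_on X N \<longleftrightarrow>
     (\<forall>x\<in>X. 0 \<le> N x) \<and> (\<forall>x\<in>X. N x = 0 \<longleftrightarrow> x = 0) \<and>
     (\<forall>c. \<forall>x\<in>X. N (c *\<^sub>R x) = \<bar>c\<bar> * N x) \<and>
     (\<forall>x\<in>X. \<forall>y\<in>X. N (x + y) \<le> N x + N y)"

definition banach_space_on :: "'a::real_vector set \<Rightarrow> ('a \<Rightarrow> real) \<Rightarrow> bool" where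
  "banach_space_on X N \<longleftrightarrow>
     subspace X \<and> norm_on X N \<and>
     (\<forall>\<sigma>. (\<forall>n. \<sigma> n \<in> X) \<and> (\<forall>e>0. \<exists>M::nat. \<forall>m\<ge>M. \<forall>n\<ge>M. N (\<sigma> m - \<sigma> n) < e)
        \<longrightarrow> (\<exists>x\<in>X. (\<lambda>n. N (\<sigma> n - x)) \<longlonglongrightarrow> 0))"

end

theory Submission imports Defs begin

text \<open>
  The idea is to replace the cylindrical measure by a random functional on a genuine probability space,
  and thereby the space of radonifying operators by a space of pairs of an operator and a random vector.

  Kolmogorov's extension theorem, applied with the dual of the Hilbert space as index set, gives real
  random variables \<open>X w\<close>, one for each functional \<open>w\<close>, whose joint laws are those prescribed by the
  cylindrical measure (\<open>exists_cylindrical_process\<close>).  They depend on \<open>w\<close> linearly, up to null sets.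
  An operator \<open>T\<close> is radonifying exactly if there is a random vector \<open>Y\<close> with \<open>w (Y \<omega>) = X (w o\<^sub>L T) \<omega>\<close>
  almost surely, for each functional \<open>w\<close>; then the law of \<open>Y\<close> is the extension of the image measure
  (\<open>exists_representative\<close>, \<open>represents_image_law\<close>).  The vector \<open>Y\<close> is built from countably many
  coordinates: a separable Banach space has a sequence of functionals that determines the norm, by the
  Hahn-Banach theorem, and a point can be recovered measurably from the values of these functionals
  (\<open>measurable_recovery_from_coordinates\<close>).

  In this picture the algebra is easy.  If \<open>Y\<close> and \<open>Z\<close> represent \<open>S\<close> and \<open>T\<close>, then \<open>Y + Z\<close>
  represents \<open>S + T\<close>, although a sum of operators has no direct description in terms of the two image
  measures.  The norm of \<open>T\<close> is the Lebesgue norm of order \<open>p\<close> of its representative plus the operator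
  norm: the triangle inequality is Minkowski's, and definiteness comes from the operator norm.

  For completeness, a Cauchy sequence of operators converges in operator norm to some \<open>L\<close>, and the
  representatives converge in mean of order \<open>p\<close>, and almost surely along a subsequence, to some \<open>Z\<close>.
  The point is that \<open>Z\<close> represents \<open>L\<close>, and this is where continuity of the characteristic function
  enters: it forces \<open>X v\<close> to tend to \<open>X w\<close> in probability as \<open>v\<close> tends to \<open>w\<close> in the dual norm
  (\<open>AE_limit_of_X\<close>).
\<close>

section \<open>Norming functionals\<close>

text \<open>
  Demanding only an inequality for positive scalars, and nothing at zero, makes the closure
  properties below short to check; equality for all nonnegative scalars follows.
\<close>

definition sublinear :: "('v::real_vector \<Rightarrow> real) \<Rightarrow> bool" where
  "sublinear q \<longleftrightarrow> (\<forall>x y. q (x + y) \<le> q x + q y) \<and> (\<forall>c>0. \<forall>x. q (c *\<^sub>R x) \<le> c * q x)"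

lemma sublinear_add: "sublinear q \<Longrightarrow> q (x + y) \<le> q x + q y"
  by (simp add: sublinear_def)

lemma sublinear_scale_le: "sublinear q \<Longrightarrow> 0 < c \<Longrightarrow> q (c *\<^sub>R x) \<le> c * q x"
  by (simp add: sublinear_def)

lemma sublinear_zero: "sublinear q \<Longrightarrow> q 0 = 0"
  using sublinear_scale_le[of q 2 0] sublinear_scale_le[of q "1/2" 0] by simp

lemma sublinear_scale:
  assumes "sublinear q" "0 \<le> c"
  shows "q (c *\<^sub>R x) = c * q x"
proof (cases "c = 0")
  case True
  then show ?thesis using sublinear_zero[OF assms(1)] by simp
next
  case False
  then have c: "0 < c" using assms by simp
  have "q x = q ((1 / c) *\<^sub>R c *\<^sub>R x)" using c by simp
  also have "\<dots> \<le> (1 / c) * q (c *\<^sub>R x)"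
    using c by (intro sublinear_scale_le assms) simp
  finally have "c * q x \<le> q (c *\<^sub>R x)"
    using c by (simp add: field_simps)
  then show ?thesis
    using sublinear_scale_le[OF assms(1) c, of x] by simp
qed

lemma sublinear_minus: "sublinear q \<Longrightarrow> - q (- x) \<le> q x"
  using sublinear_add[of q x "- x"] sublinear_zero[of q] by simp

text \<open>
  For sublinear \<open>q\<close> the expression decreases with \<open>t\<close>, so the infimum is a limit and the result is additive in the
  direction \<open>y\<close>.  A linear functional below \<open>q\<close> that agrees with \<open>q\<close> at \<open>y\<close> also stays below the
  result.
\<close>

definition lower_along :: "('v::real_vector \<Rightarrow> real) \<Rightarrow> 'v \<Rightarrow> 'v \<Rightarrow> real" where
  "lower_along q y x = (INF t\<in>{0..}. q (x + t *\<^sub>R y) - t * q y)"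

lemma lower_along_le:
  assumes "sublinear q" "0 \<le> t"
  shows "lower_along q y x \<le> q (x + t *\<^sub>R y) - t * q y"
proof -
  have "- q (- x) \<le> q (x + s *\<^sub>R y) - s * q y" if "0 \<le> s" for s
    using sublinear_add[OF assms(1), of "x + s *\<^sub>R y" "- x"] sublinear_scale[OF assms(1) that, of y]
    by simp
  then have "bdd_below ((\<lambda>t. q (x + t *\<^sub>R y) - t * q y) ` {0..})"
    by (intro bdd_belowI2) auto
  then show ?thesis
    unfolding lower_along_def using assms(2) by (intro cINF_lower) auto
qed

lemma lower_along_greatest:
  "(\<And>t. 0 \<le> t \<Longrightarrow> a \<le> q (x + t *\<^sub>R y) - t * q y) \<Longrightarrow> a \<le> lower_along q y x"
  unfolding lower_along_def by (intro cINF_greatest) auto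

lemma sublinear_lower_along:
  assumes q: "sublinear q"
  shows "sublinear (lower_along q y)"
  unfolding sublinear_def
proof (intro conjI allI impI)
  fix x x'
  have "lower_along q y (x + x') - (q (x + s *\<^sub>R y) - s * q y) \<le> q (x' + t *\<^sub>R y) - t * q y"
    if "0 \<le> s" "0 \<le> t" for s t
  proof -
    have "lower_along q y (x + x') \<le> q (x + x' + (s + t) *\<^sub>R y) - (s + t) * q y"
      using that by (intro lower_along_le q) simp
    also have "q (x + x' + (s + t) *\<^sub>R y) \<le> q (x + s *\<^sub>R y) + q (x' + t *\<^sub>R y)"
      using sublinear_add[OF q, of "x + s *\<^sub>R y" "x' + t *\<^sub>R y"] by (simp add: algebra_simps)
    finally show ?thesis by (simp add: algebra_simps)
  qed
  then have "lower_along q y (x + x') - (q (x + s *\<^sub>R y) - s * q y) \<le> lower_along q y x'"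
    if "0 \<le> s" for s
    using that by (intro lower_along_greatest) auto
  then have "lower_along q y (x + x') - lower_along q y x' \<le> lower_along q y x"
    by (intro lower_along_greatest) (simp add: algebra_simps)
  then show "lower_along q y (x + x') \<le> lower_along q y x + lower_along q y x'" by simp
next
  fix c :: real and x assume c: "0 < c"
  have "(1 / c) * lower_along q y (c *\<^sub>R x) \<le> q (x + t *\<^sub>R y) - t * q y" if "0 \<le> t" for t
  proof -
    have "lower_along q y (c *\<^sub>R x) \<le> q (c *\<^sub>R x + (c * t) *\<^sub>R y) - (c * t) * q y"
      using that c by (intro lower_along_le q) simp
    also have "q (c *\<^sub>R x + (c * t) *\<^sub>R y) = c * q (x + t *\<^sub>R y)"
      using sublinear_scale[OF q, of c "x + t *\<^sub>R y"] c by (simp add: algebra_simps)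
    finally show ?thesis using c by (simp add: field_simps)
  qed
  then have "(1 / c) * lower_along q y (c *\<^sub>R x) \<le> lower_along q y x"
    by (rule lower_along_greatest)
  then show "lower_along q y (c *\<^sub>R x) \<le> c * lower_along q y x"
    using c by (simp add: field_simps)
qed

lemma lower_along_le_self: "sublinear q \<Longrightarrow> lower_along q y x \<le> q x"
  using lower_along_le[of q 0 y x] by simp

text \<open>
  By minimality \<open>q\<close> equals its own lowering along any \<open>y\<close>, and the term \<open>t = 1\<close> of the infimum then
  says \<open>q x \<le> q (x + y) - q y\<close>, the converse of subadditivity.
\<close>

lemma linear_of_minimal_sublinear:
  assumes q: "sublinear q"
    and min: "\<And>r. sublinear r \<Longrightarrow> (\<And>x. r x \<le> q x) \<Longrightarrow> r = q"
  shows "linear q"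
proof (rule linearI)
  have add: "q (x + y) = q x + q y" for x y
  proof -
    have "lower_along q y = q"
      by (intro min sublinear_lower_along q lower_along_le_self)
    then have "q x \<le> q (x + y) - q y"
      using lower_along_le[OF q, of 1 y x] by simp
    then show ?thesis using sublinear_add[OF q, of x y] by simp
  qed
  then show "q (x + y) = q x + q y" for x y .
  have neg: "q (- x) = - q x" for x
    using add[of x "- x"] sublinear_zero[OF q] by simp
  show "q (c *\<^sub>R x) = c *\<^sub>R q x" for c x
    using sublinear_scale[OF q, of c x] sublinear_scale[OF q, of "- c" x] neg[of "c *\<^sub>R x"]
    by (cases "0 \<le> c") auto
qed

text \<open>
  The Hahn-Banach theorem in its sublinear form.  Zorn's lemma gives a minimal sublinear functional
  below \<open>p\<close>: the pointwise infimum of a chain is finite because every member satisfies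
  \<open>q x \<ge> - p (- x)\<close>, and it is subadditive because two members of a chain can be replaced by the
  smaller one.
\<close>

lemma exists_linear_below_sublinear:
  assumes p: "sublinear (p :: 'v::real_vector \<Rightarrow> real)"
  obtains f where "linear f" "\<And>x. f x \<le> p x"
proof -
  define A where "A = {q. sublinear q \<and> (\<forall>x. q x \<le> p x)}"
  define P where "P q r \<longleftrightarrow> (\<forall>x. r x \<le> q x)" for q r :: "'v \<Rightarrow> real"
  have "\<exists>m\<in>A. \<forall>a\<in>A. P m a \<longrightarrow> a = m"
  proof (rule predicate_Zorn)
    show "partial_order_on A (relation_of P A)"
      unfolding partial_order_on_def preorder_on_def refl_on_def trans_def antisym_def relation_of_def P_def
      by (auto intro: order_trans intro!: ext order_antisym)
  next
    fix C assume C: "C \<in> Chains (relation_of P A)"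
    then have CA: "C \<subseteq> A" by (auto simp: Chains_def relation_of_def)
    show "\<exists>u\<in>A. \<forall>a\<in>C. P a u"
    proof (cases "C = {}")
      case True
      then show ?thesis using p by (auto simp: A_def)
    next
      case False
      define u where "u x = (INF q\<in>C. q x)" for x
      have "- p (- x) \<le> q x" if "q \<in> C" for q x
      proof -
        have q: "sublinear q" "q (- x) \<le> p (- x)" using that CA by (auto simp: A_def)
        then show ?thesis using sublinear_minus[OF q(1), of x] by simp
      qed
      then have u_le: "u x \<le> q x" if "q \<in> C" for q x
        unfolding u_def using that by (intro cINF_lower bdd_belowI2[of _ "- p (- x)"]) auto
      have u_greatest: "a \<le> u x" if "\<And>q. q \<in> C \<Longrightarrow> a \<le> q x" for a x
        unfolding u_def using that False by (intro cINF_greatest) auto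
      have "u (x + y) - q x \<le> r y" if qr: "q \<in> C" "r \<in> C" for q r x y
      proof -
        have sub: "sublinear q" "sublinear r" using qr CA by (auto simp: A_def)
        have "(\<forall>x. q x \<le> r x) \<or> (\<forall>x. r x \<le> q x)"
          using C qr by (auto simp: Chains_def relation_of_def P_def)
        then show ?thesis
        proof
          assume "\<forall>x. q x \<le> r x"
          then show ?thesis
            using u_le[OF qr(1), of "x + y"] sublinear_add[OF sub(1), of x y] by (smt (verit))
        next
          assume "\<forall>x. r x \<le> q x"
          then show ?thesis
            using u_le[OF qr(2), of "x + y"] sublinear_add[OF sub(2), of x y] by (smt (verit))
        qed
      qed
      then have "u (x + y) - q x \<le> u y" if "q \<in> C" for q x y
        using that by (intro u_greatest) auto
      then have "u (x + y) - u y \<le> u x" for x y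
        by (intro u_greatest) (smt (verit))
      moreover have "u (c *\<^sub>R x) \<le> c * u x" if c: "0 < c" for c x
      proof -
        have "(1 / c) * u (c *\<^sub>R x) \<le> q x" if "q \<in> C" for q
        proof -
          have "u (c *\<^sub>R x) \<le> c * q x"
            using u_le[OF that, of "c *\<^sub>R x"] sublinear_scale_le[of q c x] that CA c
            by (force simp: A_def)
          then show ?thesis using c by (simp add: field_simps)
        qed
        then have "(1 / c) * u (c *\<^sub>R x) \<le> u x" by (rule u_greatest)
        then show ?thesis using c by (simp add: field_simps)
      qed
      ultimately have "sublinear u"
        by (auto simp: sublinear_def algebra_simps)
      moreover have "u x \<le> p x" for x
        using False CA u_le by (force simp: A_def intro: order_trans)
      ultimately have "u \<in> A" by (simp add: A_def)
      then show ?thesis using u_le by (auto simp: P_def)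
    qed
  qed
  then obtain m where m: "m \<in> A" "\<And>a. a \<in> A \<Longrightarrow> P m a \<Longrightarrow> a = m" by blast
  have "linear m"
  proof (rule linear_of_minimal_sublinear)
    show "sublinear m" using m(1) by (simp add: A_def)
    fix r assume r: "sublinear r" "\<And>x. r x \<le> m x"
    then have "r \<in> A" using m(1) by (auto simp: A_def intro: order_trans)
    then show "r = m" using m(2) r(2) by (simp add: P_def)
  qed
  then show ?thesis using that m(1) by (simp add: A_def)
qed

text \<open>
  A linear functional below the norm is bounded by the norm.  Starting instead from the norm lowered
  along \<open>x0\<close> forces the value at \<open>- x0\<close> down to \<open>- norm x0\<close>.
\<close>

lemma exists_norming_functional:
  fixes x0 :: "'v::real_normed_vector"
  obtains f :: "'v \<Rightarrow>\<^sub>L real" where "norm f \<le> 1" "f x0 = norm x0"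
proof -
  have norm: "sublinear (norm :: 'v \<Rightarrow> real)"
    by (auto simp: sublinear_def norm_triangle_ineq)
  obtain f where f: "linear f" and le: "\<And>x. f x \<le> lower_along norm x0 x"
    using exists_linear_below_sublinear[OF sublinear_lower_along[OF norm]] by metis
  have le_norm: "f x \<le> norm x" for x
    using le[of x] lower_along_le_self[OF norm, of x0 x] by simp
  then have abs_le: "\<bar>f x\<bar> \<le> norm x" for x
    using le_norm[of x] le_norm[of "- x"] linear_neg[OF f, of x] by (simp add: abs_le_iff)
  have "f (- x0) \<le> - norm x0"
    using le[of "- x0"] lower_along_le[OF norm, of 1 x0 "- x0"] by simp
  then have f_x0: "f x0 = norm x0"
    using le_norm[of x0] linear_neg[OF f, of x0] by simp
  have bl: "bounded_linear f"
    using f abs_le unfolding linear_conv_bounded_linear[symmetric]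
    by (intro bounded_linear_intro[of f 1]) (auto simp: linear_add linear_scale)
  show ?thesis
  proof
    show "norm (Blinfun f) \<le> 1"
      using abs_le by (intro norm_blinfun_bound) (auto simp: bounded_linear_Blinfun_apply[OF bl])
    show "Blinfun f x0 = norm x0"
      using f_x0 by (simp add: bounded_linear_Blinfun_apply[OF bl])
  qed
qed

section \<open>Recovering a point from countably many coordinates\<close>

text \<open>
  Such a sequence embeds the space isometrically into the bounded sequences.
\<close>

definition norming_sequence :: "(nat \<Rightarrow> 'v::real_normed_vector \<Rightarrow>\<^sub>L real) \<Rightarrow> bool" where
  "norming_sequence u \<longleftrightarrow>
     (\<forall>n. norm (u n) \<le> 1) \<and> (\<forall>v a. (\<forall>n. \<bar>blinfun_apply (u n) v\<bar> \<le> a) \<longrightarrow> norm v \<le> a)"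

text \<open>
  Functionals norming the points of a countable dense set suffice: near \<open>v\<close> there is a dense point
  \<open>d\<close>, and the functional that norms \<open>d\<close> nearly norms \<open>v\<close>.
\<close>

lemma exists_norming_sequence:
  "\<exists>u :: nat \<Rightarrow> 'v::{real_normed_vector, second_countable_topology} \<Rightarrow>\<^sub>L real. norming_sequence u"
proof -
  obtain D :: "'v set" where D: "countable D" "\<And>X. open X \<Longrightarrow> X \<noteq> {} \<Longrightarrow> \<exists>d\<in>D. d \<in> X"
    by (rule countable_dense_setE) auto
  have "\<exists>f :: 'v \<Rightarrow>\<^sub>L real. norm f \<le> 1 \<and> blinfun_apply f x = norm x" for x
    by (rule exists_norming_functional[of x]) auto
  then obtain F :: "'v \<Rightarrow> 'v \<Rightarrow>\<^sub>L real" where F: "\<And>x. norm (F x) \<le> 1" "\<And>x. blinfun_apply (F x) x = norm x"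
    by metis
  have "norming_sequence (\<lambda>n. F (from_nat_into D n))"
    unfolding norming_sequence_def
  proof (intro conjI allI impI)
    show "norm (F (from_nat_into D n)) \<le> 1" for n by (rule F)
  next
    fix v a assume a: "\<forall>n. \<bar>F (from_nat_into D n) v\<bar> \<le> a"
    show "norm v \<le> a"
    proof (rule field_le_epsilon)
      fix e :: real assume e: "0 < e"
      obtain d where d: "d \<in> D" "dist v d < e / 2"
        using D(2)[of "ball v (e / 2)"] e by auto
      have "\<bar>F d (d - v)\<bar> \<le> norm (F d) * norm (d - v)"
        using norm_blinfun[of "F d" "d - v"] by simp
      also have "\<dots> \<le> 1 * norm (d - v)" by (intro mult_right_mono F) simp
      finally have "norm d - F d v \<le> norm (d - v)" by (simp add: blinfun.diff_right F)
      moreover have "F d v \<le> a"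
        using a[rule_format, of "to_nat_on D d"] d(1) D(1) by simp
      moreover have "norm v \<le> norm d + norm (d - v)"
        by (metis norm_triangle_sub norm_minus_commute)
      ultimately show "norm v \<le> a + e"
        using d(2) by (simp add: dist_norm norm_minus_commute)
    qed
  qed
  then show ?thesis by blast
qed

text \<open>
  A measurable left inverse of the embedding into sequences.  To recover \<open>v\<close> from its coordinates to
  precision \<open>1 / k\<close>, take the first point of a dense sequence whose coordinates are uniformly that
  close; this choice depends measurably on the coordinates, and the chosen points converge to \<open>v\<close>
  because the sequence is norming.  The map is defined on all real sequences, with arbitrary values off the
  range of the embedding, so that neither the range nor its measurability has to be discussed.
\<close>

lemma measurable_recovery_from_coordinates:
  fixes u :: "nat \<Rightarrow> 'v::{banach, second_countable_topology} \<Rightarrow>\<^sub>L real"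
  assumes u: "norming_sequence u"
  obtains K where "K \<in> (\<Pi>\<^sub>M i\<in>UNIV. borel :: real measure) \<rightarrow>\<^sub>M borel" "\<And>v. K (\<lambda>n. u n v) = v"
proof -
  have u1: "norm (u n) \<le> 1" for n
    using u by (simp add: norming_sequence_def)
  have norming: "norm v \<le> a" if "\<And>n. \<bar>blinfun_apply (u n) v\<bar> \<le> a" for v a
    using u that by (simp add: norming_sequence_def)
  obtain D :: "'v set" where D: "countable D" "\<And>X. open X \<Longrightarrow> X \<noteq> {} \<Longrightarrow> \<exists>d\<in>D. d \<in> X"
    by (rule countable_dense_setE) auto
  define d where "d = from_nat_into D"
  define m where "m k x = (LEAST m. \<forall>n. \<bar>x n - u n (d m)\<bar> \<le> 1 / real (Suc k))" for k :: nat and x :: "nat \<Rightarrow> real"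
  define K where "K x = lim (\<lambda>k. d (m k x))" for x
  have "Measurable.pred (\<Pi>\<^sub>M i\<in>UNIV. borel :: real measure) (\<lambda>x. \<bar>x n - u n (d j)\<bar> \<le> 1 / real (Suc k))" for n j k
    by measurable
  then have [measurable]: "m k \<in> (\<Pi>\<^sub>M i\<in>UNIV. borel) \<rightarrow>\<^sub>M count_space UNIV" for k
    unfolding m_def by (intro measurable_Least pred_intros_countable)
  have [measurable]: "(\<lambda>x. d (m k x)) \<in> (\<Pi>\<^sub>M i\<in>UNIV. borel) \<rightarrow>\<^sub>M borel" for k
    by measurable
  show ?thesis
  proof
    show "K \<in> (\<Pi>\<^sub>M i\<in>UNIV. borel :: real measure) \<rightarrow>\<^sub>M borel"
      unfolding K_def by (intro borel_measurable_lim_metric) simp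
  next
    fix v
    have "norm (d (m k (\<lambda>n. u n v)) - v) \<le> 1 / real (Suc k)" for k
    proof -
      obtain e where e: "e \<in> D" "dist v e < 1 / real (Suc k)"
        using D(2)[of "ball v (1 / real (Suc k))"] by auto
      have "\<bar>u n v - u n e\<bar> \<le> 1 / real (Suc k)" for n
      proof -
        have "\<bar>u n (v - e)\<bar> \<le> norm (u n) * norm (v - e)"
          using norm_blinfun[of "u n" "v - e"] by simp
        also have "\<dots> \<le> 1 * norm (v - e)" by (intro mult_right_mono u1) simp
        finally show ?thesis using e(2) by (simp add: blinfun.diff_right dist_norm)
      qed
      then have "\<forall>n. \<bar>u n v - u n (d (to_nat_on D e))\<bar> \<le> 1 / real (Suc k)"
        using e(1) D(1) by (simp add: d_def)
      then have "\<forall>n. \<bar>u n v - u n (d (m k (\<lambda>n. u n v)))\<bar> \<le> 1 / real (Suc k)"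
        unfolding m_def by (rule LeastI[where P = "\<lambda>m. \<forall>n. \<bar>u n v - u n (d m)\<bar> \<le> 1 / real (Suc k)"])
      then have "norm (v - d (m k (\<lambda>n. u n v))) \<le> 1 / real (Suc k)"
        by (intro norming) (simp add: blinfun.diff_right)
      then show ?thesis by (simp add: norm_minus_commute)
    qed
    then have "(\<lambda>k. d (m k (\<lambda>n. u n v)) - v) \<longlonglongrightarrow> 0"
      by (intro Lim_null_comparison[OF _ LIMSEQ_inverse_real_of_nat] always_eventually allI)
         (simp only: inverse_eq_divide)
    then have "(\<lambda>k. d (m k (\<lambda>n. u n v))) \<longlonglongrightarrow> v"
      by (simp add: LIM_zero_cancel)
    then show "K (\<lambda>n. u n v) = v"
      unfolding K_def by (rule limI)
  qed
qed

text \<open>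
  The events that depend on finitely many terms of a sequence of reals generate the product
  \<open>\<sigma>\<close>-algebra.
\<close>

lemma distr_sequence_eqI:
  fixes \<xi> :: "nat \<Rightarrow> 'a \<Rightarrow> real" and \<zeta> :: "nat \<Rightarrow> 'b \<Rightarrow> real"
  assumes "finite_measure M"
    and [measurable]: "\<And>i. \<xi> i \<in> borel_measurable M" "\<And>i. \<zeta> i \<in> borel_measurable N"
    and eq: "\<And>n B. B \<in> sets (Pi\<^sub>M {..<n} (\<lambda>_. borel)) \<Longrightarrow>
      emeasure M {x \<in> space M. (\<lambda>i\<in>{..<n}. \<xi> i x) \<in> B} =
      emeasure N {x \<in> space N. (\<lambda>i\<in>{..<n}. \<zeta> i x) \<in> B}"
  shows "distr M (Pi\<^sub>M UNIV (\<lambda>_. borel)) (\<lambda>x i. \<xi> i x) = distr N (Pi\<^sub>M UNIV (\<lambda>_. borel)) (\<lambda>x i. \<zeta> i x)"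
proof (rule measure_eqI_PiM_infinite)
  have [measurable]: "(\<lambda>x i. \<xi> i x) \<in> M \<rightarrow>\<^sub>M Pi\<^sub>M UNIV (\<lambda>_. borel)"
    "(\<lambda>x i. \<zeta> i x) \<in> N \<rightarrow>\<^sub>M Pi\<^sub>M UNIV (\<lambda>_. borel)"
    by (auto intro!: measurable_PiM_single')
  interpret finite_measure M by fact
  show "finite_measure (distr M (Pi\<^sub>M UNIV (\<lambda>_. borel)) (\<lambda>x i. \<xi> i x))"
    by (intro finite_measure_distr) measurable
  fix A :: "nat \<Rightarrow> real set" and J :: "nat set"
  assume J: "finite J" and A: "\<And>i. i \<in> J \<Longrightarrow> A i \<in> sets borel"
  obtain n where n: "J \<subseteq> {..<n}"
    using J finite_nat_iff_bounded by blast
  define B where "B = {x \<in> space (Pi\<^sub>M {..<n} (\<lambda>_. borel)). \<forall>i\<in>J. x i \<in> A i}"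
  have "B = prod_emb {..<n} (\<lambda>_. borel) J (Pi\<^sub>E J A)"
    using n by (auto simp: B_def prod_emb_def space_PiM PiE_iff extensional_def)
  also have "\<dots> \<in> sets (Pi\<^sub>M {..<n} (\<lambda>_. borel))"
    using J A n by (intro measurable_prod_emb sets_PiM_I_finite) auto
  finally have B: "B \<in> sets (Pi\<^sub>M {..<n} (\<lambda>_. borel))" .
  have [measurable]: "prod_emb UNIV (\<lambda>_. borel) J (Pi\<^sub>E J A) \<in> sets (Pi\<^sub>M UNIV (\<lambda>_. borel))"
    using J A by (intro sets_PiM_I) auto
  have pre: "(\<lambda>x i. f i x) -` prod_emb UNIV (\<lambda>_. borel) J (Pi\<^sub>E J A) \<inter> S = {x \<in> S. (\<lambda>i\<in>{..<n}. f i x) \<in> B}"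
    for f :: "nat \<Rightarrow> 'c \<Rightarrow> real" and S
    using n by (auto simp: B_def prod_emb_def space_PiM PiE_iff subset_iff)
  show "emeasure (distr M (Pi\<^sub>M UNIV (\<lambda>_. borel)) (\<lambda>x i. \<xi> i x)) (prod_emb UNIV (\<lambda>_. borel) J (Pi\<^sub>E J A)) =
    emeasure (distr N (Pi\<^sub>M UNIV (\<lambda>_. borel)) (\<lambda>x i. \<zeta> i x)) (prod_emb UNIV (\<lambda>_. borel) J (Pi\<^sub>E J A))"
    by (simp add: emeasure_distr pre eq[OF B])
qed auto

lemma borel_measurable_blinfun_apply [measurable]:
  "blinfun_apply (w :: 'v::real_normed_vector \<Rightarrow>\<^sub>L 'w::real_normed_vector) \<in> borel_measurable borel"
  by (intro borel_measurable_continuous_onI linear_continuous_on blinfun.bounded_linear_right)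

lemma borel_extension_emeasure:
  assumes "borel_extension \<eta> \<mu>" "B \<in> sets (Pi\<^sub>M {..<n} (\<lambda>_. borel))"
  shows "emeasure \<mu> {v \<in> space \<mu>. (\<lambda>i\<in>{..<n}. blinfun_apply (vs i) v) \<in> B} = \<eta> (cyl_proj n vs -` B)"
proof -
  have "space \<mu> = UNIV"
    using assms(1) sets_eq_imp_space_eq[of \<mu> borel] by (simp add: borel_extension_def)
  then have "{v \<in> space \<mu>. (\<lambda>i\<in>{..<n}. blinfun_apply (vs i) v) \<in> B} = cyl_proj n vs -` B"
    by (auto simp: cyl_proj_def)
  moreover have "cyl_proj n vs -` B \<in> cyl_sets UNIV"
    unfolding cyl_sets_def using assms(2) by blast
  ultimately show ?thesis
    using assms(1) by (simp add: borel_extension_def)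
qed

text \<open>
  Two extensions give the coordinates of a norming sequence the same finite-dimensional laws, hence
  the same law on the space of sequences; the measurable left inverse carries this law back.
\<close>

lemma borel_extension_unique:
  fixes \<mu> \<nu> :: "'v::{banach, second_countable_topology} measure"
  assumes \<mu>: "borel_extension \<eta> \<mu>" and \<nu>: "borel_extension \<eta> \<nu>"
  shows "\<mu> = \<nu>"
proof -
  obtain u :: "nat \<Rightarrow> 'v \<Rightarrow>\<^sub>L real" where "norming_sequence u"
    using exists_norming_sequence by blast
  then obtain K where K [measurable]: "K \<in> (\<Pi>\<^sub>M i\<in>UNIV. borel :: real measure) \<rightarrow>\<^sub>M borel"
    and Ku: "\<And>v. K (\<lambda>n. u n v) = v"
    using measurable_recovery_from_coordinates by blast
  have [measurable_cong]: "sets \<mu> = sets borel" "sets \<nu> = sets borel"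
    using \<mu> \<nu> by (auto simp: borel_extension_def)
  have J [measurable]: "(\<lambda>v i. u i v) \<in> borel \<rightarrow>\<^sub>M Pi\<^sub>M UNIV (\<lambda>_. borel)"
    by (auto intro!: measurable_PiM_single')
  have recover: "\<kappa> = distr (distr \<kappa> (Pi\<^sub>M UNIV (\<lambda>_. borel)) (\<lambda>v i. u i v)) borel K"
    if [measurable_cong]: "sets \<kappa> = sets borel" for \<kappa> :: "'v measure"
  proof -
    have "distr (distr \<kappa> (Pi\<^sub>M UNIV (\<lambda>_. borel)) (\<lambda>v i. u i v)) borel K = distr \<kappa> borel (\<lambda>v. v)"
      by (subst distr_distr) (auto simp: comp_def Ku)
    then show ?thesis using that by (simp add: distr_id2)
  qed
  have "prob_space \<mu>" using \<mu> by (simp add: borel_extension_def)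
  then have "distr \<mu> (Pi\<^sub>M UNIV (\<lambda>_. borel)) (\<lambda>v i. u i v) = distr \<nu> (Pi\<^sub>M UNIV (\<lambda>_. borel)) (\<lambda>v i. u i v)"
    by (intro distr_sequence_eqI)
       (auto simp: borel_extension_emeasure[OF \<mu>] borel_extension_emeasure[OF \<nu>] prob_space.finite_measure)
  then show ?thesis
    using recover[of \<mu>] recover[of \<nu>] \<mu> \<nu> by (simp add: borel_extension_def)
qed

lemma image_law_eqI:
  fixes T :: "'h::real_normed_vector \<Rightarrow>\<^sub>L 'v::{banach, second_countable_topology}"
  assumes "borel_extension (cyl_image \<theta> T) \<mu>"
  shows "image_law \<theta> T = \<mu>"
  unfolding image_law_def using assms borel_extension_unique by blast

section \<open>Cylindrical measures as random functionals\<close>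

text \<open>
  A cylindrical measure viewed as a random functional: the variable \<open>X w\<close> plays the part of the
  functional \<open>w\<close> evaluated at a random point that need not exist.
\<close>

locale cylindrical_process = prob_space M
  for M :: "'a measure"
    and \<theta> :: "'h::real_normed_vector set \<Rightarrow> ennreal"
    and X :: "('h \<Rightarrow>\<^sub>L real) \<Rightarrow> 'a \<Rightarrow> real" +
  assumes cylindrical_prob_\<theta>: "cylindrical_prob \<theta>"
    and random_variable_X [measurable]: "X w \<in> borel_measurable M"
    and joint_law: "B \<in> sets (Pi\<^sub>M {..<n} (\<lambda>_. borel)) \<Longrightarrow>
      emeasure M {\<omega> \<in> space M. (\<lambda>i\<in>{..<n}. X (ws i) \<omega>) \<in> B} = \<theta> (cyl_proj n ws -` B)"

definition restricted_measure ::
    "('v::real_normed_vector set \<Rightarrow> ennreal) \<Rightarrow> ('v \<Rightarrow>\<^sub>L real) set \<Rightarrow> 'v measure" where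
  "restricted_measure \<eta> D = measure_of UNIV (cyl_sigma D) \<eta>"

lemma space_restricted_measure [simp]: "space (restricted_measure \<eta> D) = UNIV"
  by (simp add: restricted_measure_def space_measure_of_conv)

lemma sets_restricted_measure [simp]: "sets (restricted_measure \<eta> D) = cyl_sigma D"
  by (simp add: restricted_measure_def cyl_sigma_def sigma_sets_sigma_sets_eq)

lemma emeasure_restricted_measure:
  assumes "cylindrical_prob \<eta>" "finite D" "A \<in> cyl_sigma D"
  shows "emeasure (restricted_measure \<eta> D) A = \<eta> A"
  using assms unfolding restricted_measure_def cylindrical_prob_def measure_space_def
  by (intro emeasure_measure_of_sigma) auto

lemma prob_space_restricted_measure:
  assumes "cylindrical_prob \<eta>" "finite D"
  shows "prob_space (restricted_measure \<eta> D)"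
proof
  have "UNIV \<in> cyl_sigma D"
    by (simp add: cyl_sigma_def sigma_sets_top)
  then show "emeasure (restricted_measure \<eta> D) (space (restricted_measure \<eta> D)) = 1"
    using emeasure_restricted_measure[OF assms] assms(1) by (simp add: cylindrical_prob_def)
qed

lemma measurable_cyl_proj:
  assumes "\<And>i. i < n \<Longrightarrow> ws i \<in> D"
  shows "cyl_proj n ws \<in> restricted_measure \<eta> D \<rightarrow>\<^sub>M Pi\<^sub>M {..<n} (\<lambda>_. borel)"
proof (rule measurableI)
  show "cyl_proj n ws v \<in> space (Pi\<^sub>M {..<n} (\<lambda>_. borel))" for v
    by (auto simp: cyl_proj_def space_PiM)
  fix B assume "B \<in> sets (Pi\<^sub>M {..<n} (\<lambda>_. borel :: real measure))"
  then have "cyl_proj n ws -` B \<in> cyl_sets D"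
    unfolding cyl_sets_def using assms by blast
  then show "cyl_proj n ws -` B \<inter> space (restricted_measure \<eta> D) \<in> sets (restricted_measure \<eta> D)"
    by (simp add: cyl_sigma_def sigma_sets.Basic)
qed

lemma measurable_functional:
  assumes "w \<in> D"
  shows "blinfun_apply w \<in> borel_measurable (restricted_measure \<eta> D)"
proof -
  have "(\<lambda>v. cyl_proj 1 (\<lambda>_. w) v 0) \<in> borel_measurable (restricted_measure \<eta> D)"
    using assms by (intro measurable_compose[OF measurable_cyl_proj measurable_component_singleton]) auto
  then show ?thesis by (simp add: cyl_proj_def)
qed

text \<open>
  Kolmogorov's extension theorem, with the functionals themselves as index set.  The marginal for a
  finite set \<open>J\<close> of functionals is the image of the cylindrical measure, restricted to the
  \<open>\<sigma>\<close>-algebra of \<open>J\<close>, under evaluation; these marginals are consistent because all these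
  restrictions come from one set function.
\<close>

theorem exists_cylindrical_process:
  fixes \<theta> :: "'h::real_normed_vector set \<Rightarrow> ennreal"
  assumes \<theta>: "cylindrical_prob \<theta>"
  shows "\<exists>M :: (('h \<Rightarrow>\<^sub>L real) \<Rightarrow> real) measure. cylindrical_process M \<theta> (\<lambda>w \<omega>. \<omega> w)"
proof -
  define eval where "eval J v = (\<lambda>w\<in>J. blinfun_apply w v)" for J :: "('h \<Rightarrow>\<^sub>L real) set" and v
  define P where "P J = distr (restricted_measure \<theta> J) (Pi\<^sub>M J (\<lambda>_. borel)) (eval J)" for J
  have eval: "eval J \<in> restricted_measure \<theta> H \<rightarrow>\<^sub>M Pi\<^sub>M J (\<lambda>_. borel)" if "J \<subseteq> H" for J H
    using that unfolding eval_def by (intro measurable_restrict measurable_functional) auto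
  interpret polish_projective UNIV P
  proof (intro polish_projective.intro projective_family.intro)
    fix J H :: "('h \<Rightarrow>\<^sub>L real) set" assume JH: "J \<subseteq> H" "finite H"
    then have J: "finite J" by (blast intro: finite_subset)
    have "distr (P H) (Pi\<^sub>M J (\<lambda>_. borel)) (\<lambda>f. restrict f J) =
        distr (restricted_measure \<theta> H) (Pi\<^sub>M J (\<lambda>_. borel)) ((\<lambda>f. restrict f J) \<circ> eval H)"
      unfolding P_def using JH by (intro distr_distr measurable_restrict_subset eval) auto
    also have "(\<lambda>f. restrict f J) \<circ> eval H = eval J"
      using JH by (auto simp: eval_def fun_eq_iff restrict_def)
    also have "distr (restricted_measure \<theta> H) (Pi\<^sub>M J (\<lambda>_. borel)) (eval J) = P J"
    proof (rule measure_eqI)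
      fix A assume "A \<in> sets (distr (restricted_measure \<theta> H) (Pi\<^sub>M J (\<lambda>_. borel)) (eval J))"
      then have A: "A \<in> sets (Pi\<^sub>M J (\<lambda>_. borel))" by simp
      have "eval J -` A \<in> cyl_sigma J" "eval J -` A \<in> cyl_sigma H"
        using measurable_sets[OF eval[of J J] A] measurable_sets[OF eval[OF JH(1)] A] by auto
      then show "emeasure (distr (restricted_measure \<theta> H) (Pi\<^sub>M J (\<lambda>_. borel)) (eval J)) A = emeasure (P J) A"
        using JH J A eval[of J J] eval[OF JH(1)]
        by (simp add: P_def emeasure_distr emeasure_restricted_measure[OF \<theta>])
    qed (simp add: P_def)
    finally show "P J = distr (P H) (Pi\<^sub>M J (\<lambda>_. borel)) (\<lambda>f. restrict f J)" by (rule sym)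
  next
    fix J :: "('h \<Rightarrow>\<^sub>L real) set" assume "finite J"
    then interpret prob_space "restricted_measure \<theta> J"
      by (rule prob_space_restricted_measure[OF \<theta>])
    show "prob_space (P J)"
      unfolding P_def by (intro prob_space_distr eval) auto
  qed
  have "cylindrical_process lim \<theta> (\<lambda>w \<omega>. \<omega> w)"
  proof (unfold_locales, rule \<theta>)
    show "(\<lambda>\<omega>. \<omega> w) \<in> borel_measurable lim" for w
      by (simp add: measurable_cong_sets[OF sets_lim refl])
    fix B and n :: nat and ws :: "nat \<Rightarrow> 'h \<Rightarrow>\<^sub>L real"
    assume B: "B \<in> sets (Pi\<^sub>M {..<n} (\<lambda>_. borel :: real measure))"
    define J where "J = ws ` {..<n}"
    define g where "g f = (\<lambda>i\<in>{..<n}. f (ws i))" for f :: "('h \<Rightarrow>\<^sub>L real) \<Rightarrow> real"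
    have g: "g \<in> Pi\<^sub>M J (\<lambda>_. borel) \<rightarrow>\<^sub>M Pi\<^sub>M {..<n} (\<lambda>_. borel)"
      unfolding g_def J_def by (intro measurable_restrict measurable_component_singleton) auto
    define C where "C = g -` B \<inter> space (Pi\<^sub>M J (\<lambda>_. borel))"
    have C: "C \<in> sets (Pi\<^sub>M J (\<lambda>_. borel))"
      unfolding C_def using g B by (rule measurable_sets)
    have "{\<omega> \<in> space lim. (\<lambda>i\<in>{..<n}. \<omega> (ws i)) \<in> B} = emb UNIV J C"
    proof -
      have "g (restrict \<omega> J) = (\<lambda>i\<in>{..<n}. \<omega> (ws i))" for \<omega>
        by (auto simp: g_def J_def fun_eq_iff restrict_def)
      then show ?thesis by (auto simp: prod_emb_def C_def space_PiM)
    qed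
    then have "emeasure lim {\<omega> \<in> space lim. (\<lambda>i\<in>{..<n}. \<omega> (ws i)) \<in> B} = emeasure (P J) C"
      using emeasure_lim_emb[of J C] C by (simp add: J_def)
    also have "\<dots> = emeasure (restricted_measure \<theta> J) (eval J -` C)"
      unfolding P_def using emeasure_distr[OF eval[of J J] C] by simp
    also have "eval J -` C = cyl_proj n ws -` B"
    proof -
      have "g (eval J v) = cyl_proj n ws v" for v
        by (auto simp: g_def eval_def J_def cyl_proj_def fun_eq_iff restrict_def)
      then show ?thesis by (auto simp: C_def eval_def space_PiM)
    qed
    also have "emeasure (restricted_measure \<theta> J) (cyl_proj n ws -` B) = \<theta> (cyl_proj n ws -` B)"
    proof (rule emeasure_restricted_measure[OF \<theta>])
      show "cyl_proj n ws -` B \<in> cyl_sigma J"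
        using measurable_sets[OF measurable_cyl_proj[of n ws J \<theta>] B] by (simp add: J_def)
    qed (simp add: J_def)
    finally show "emeasure lim {\<omega> \<in> space lim. (\<lambda>i\<in>{..<n}. \<omega> (ws i)) \<in> B} = \<theta> (cyl_proj n ws -` B)" .
  qed
  then show ?thesis by blast
qed

section \<open>Random vectors representing radonifying operators\<close>

lemma cyl_proj_compose: "cyl_proj n (\<lambda>i. vs i o\<^sub>L T) h = cyl_proj n vs (blinfun_apply T h)"
  by (simp add: cyl_proj_def)

context cylindrical_process
begin

lemma joint_event:
  assumes "B \<in> sets (Pi\<^sub>M {..<n} (\<lambda>_. borel))"
  shows "{\<omega> \<in> space M. (\<lambda>i\<in>{..<n}. X (ws i) \<omega>) \<in> B} \<in> sets M"
proof -
  have "(\<lambda>\<omega>. \<lambda>i\<in>{..<n}. X (ws i) \<omega>) \<in> M \<rightarrow>\<^sub>M Pi\<^sub>M {..<n} (\<lambda>_. borel)"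
    by measurable
  from measurable_sets[OF this assms] show ?thesis
    by (simp add: vimage_def Int_def conj_commute)
qed

text \<open>
  Relations that hold between functionals at every point have probability one for the random
  functional.  This is what makes it almost surely linear.
\<close>

lemma AE_joint:
  fixes n :: nat
  assumes B: "B \<in> sets (Pi\<^sub>M {..<n} (\<lambda>_. borel))"
    and all: "\<And>h. (\<lambda>i\<in>{..<n}. blinfun_apply (ws i) h) \<in> B"
  shows "AE \<omega> in M. (\<lambda>i\<in>{..<n}. X (ws i) \<omega>) \<in> B"
proof -
  have "cyl_proj n ws -` B = UNIV"
    using all by (auto simp: cyl_proj_def)
  then have "emeasure M {\<omega> \<in> space M. (\<lambda>i\<in>{..<n}. X (ws i) \<omega>) \<in> B} = 1"
    using joint_law[OF B, of ws] cylindrical_prob_\<theta> by (simp add: cylindrical_prob_def)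
  then have "AE \<omega> in M. \<omega> \<in> {\<omega> \<in> space M. (\<lambda>i\<in>{..<n}. X (ws i) \<omega>) \<in> B}"
    by (intro AE_prob_1) (simp add: measure_def)
  then show ?thesis by auto
qed

lemma X_linear_combination:
  "AE \<omega> in M. X (a *\<^sub>R v + b *\<^sub>R w) \<omega> = a * X v \<omega> + b * X w \<omega>"
proof -
  define ws where "ws i = (if i = 0 then a *\<^sub>R v + b *\<^sub>R w else if i = 1 then v else w)" for i :: nat
  define B where "B = {x \<in> space (Pi\<^sub>M {..<3} (\<lambda>_. borel)). x 0 = a * x 1 + b * x (2::nat)}"
  have "B \<in> sets (Pi\<^sub>M {..<3} (\<lambda>_. borel))"
    unfolding B_def by measurable
  then have "AE \<omega> in M. (\<lambda>i\<in>{..<3}. X (ws i) \<omega>) \<in> B"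
    by (rule AE_joint) (auto simp: B_def space_PiM ws_def blinfun.add_left blinfun.scaleR_left)
  then show ?thesis
    by (rule AE_mp) (auto simp: B_def ws_def)
qed

text \<open>
  Both integrals are integrals of the same function over the common one-dimensional law.
\<close>

lemma expectation_exp_X:
  "(LINT \<omega>|M. exp (\<i> * complex_of_real (X w \<omega>))) = cyl_char \<theta> w"
proof -
  let ?S = "Pi\<^sub>M {..<1::nat} (\<lambda>_. borel :: real measure)"
  let ?f = "\<lambda>x. exp (\<i> * complex_of_real (x (0::nat)))"
  have X: "(\<lambda>\<omega>. \<lambda>i\<in>{..<1}. X w \<omega>) \<in> M \<rightarrow>\<^sub>M ?S"
    by measurable
  have c: "cyl_proj 1 (\<lambda>_. w) \<in> restricted_measure \<theta> {w} \<rightarrow>\<^sub>M ?S"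
    by (rule measurable_cyl_proj) simp
  have f: "?f \<in> borel_measurable ?S"
    by measurable
  have "distr M ?S (\<lambda>\<omega>. \<lambda>i\<in>{..<1}. X w \<omega>) = distr (restricted_measure \<theta> {w}) ?S (cyl_proj 1 (\<lambda>_. w))"
  proof (rule measure_eqI)
    fix B assume "B \<in> sets (distr M ?S (\<lambda>\<omega>. \<lambda>i\<in>{..<1}. X w \<omega>))"
    then have B: "B \<in> sets ?S" by simp
    have "emeasure (distr M ?S (\<lambda>\<omega>. \<lambda>i\<in>{..<1}. X w \<omega>)) B = \<theta> (cyl_proj 1 (\<lambda>_. w) -` B)"
      using joint_law[OF B, of "\<lambda>_. w"] emeasure_distr[OF X B]
      by (simp add: vimage_def Int_def conj_commute)
    also have "\<dots> = emeasure (distr (restricted_measure \<theta> {w}) ?S (cyl_proj 1 (\<lambda>_. w))) B"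
      using measurable_sets[OF c B] emeasure_distr[OF c B]
      by (simp add: emeasure_restricted_measure[OF cylindrical_prob_\<theta>])
    finally show "emeasure (distr M ?S (\<lambda>\<omega>. \<lambda>i\<in>{..<1}. X w \<omega>)) B =
      emeasure (distr (restricted_measure \<theta> {w}) ?S (cyl_proj 1 (\<lambda>_. w))) B" .
  qed simp
  then have "(LINT x|distr M ?S (\<lambda>\<omega>. \<lambda>i\<in>{..<1}. X w \<omega>). ?f x) =
      (LINT x|distr (restricted_measure \<theta> {w}) ?S (cyl_proj 1 (\<lambda>_. w)). ?f x)" by simp
  then show ?thesis
    unfolding cyl_char_def restricted_measure_def[symmetric] integral_distr[OF X f] integral_distr[OF c f]
    by (simp add: cyl_proj_def)
qed

text \<open>
  The random vector \<open>Y\<close> is the image under \<open>T\<close> of the random point that the process describes.  The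
  exceptional null set may depend on \<open>w\<close>, of which there are uncountably many.
\<close>

definition represents :: "('h \<Rightarrow>\<^sub>L 'v::real_normed_vector) \<Rightarrow> ('a \<Rightarrow> 'v) \<Rightarrow> bool" where
  "represents T Y \<longleftrightarrow>
     Y \<in> borel_measurable M \<and> (\<forall>w. AE \<omega> in M. blinfun_apply w (Y \<omega>) = X (w o\<^sub>L T) \<omega>)"

lemma represents_linear_combination:
  fixes S T :: "'h \<Rightarrow>\<^sub>L 'v::{banach, second_countable_topology}"
  assumes "represents S Y" "represents T Z"
  shows "represents (a *\<^sub>R S + b *\<^sub>R T) (\<lambda>\<omega>. a *\<^sub>R Y \<omega> + b *\<^sub>R Z \<omega>)"
  unfolding represents_def
proof (intro conjI allI)
  have [measurable]: "Y \<in> borel_measurable M" "Z \<in> borel_measurable M"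
    using assms by (auto simp: represents_def)
  show "(\<lambda>\<omega>. a *\<^sub>R Y \<omega> + b *\<^sub>R Z \<omega>) \<in> borel_measurable M"
    by measurable
  fix w :: "'v \<Rightarrow>\<^sub>L real"
  have comb: "w o\<^sub>L (a *\<^sub>R S + b *\<^sub>R T) = a *\<^sub>R (w o\<^sub>L S) + b *\<^sub>R (w o\<^sub>L T)"
    by (intro blinfun_eqI) (simp add: blinfun.bilinear_simps)
  have "AE \<omega> in M. blinfun_apply w (Y \<omega>) = X (w o\<^sub>L S) \<omega>"
    "AE \<omega> in M. blinfun_apply w (Z \<omega>) = X (w o\<^sub>L T) \<omega>"
    using assms by (auto simp: represents_def)
  then show "AE \<omega> in M. blinfun_apply w (a *\<^sub>R Y \<omega> + b *\<^sub>R Z \<omega>) = X (w o\<^sub>L (a *\<^sub>R S + b *\<^sub>R T)) \<omega>"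
    using X_linear_combination[of a "w o\<^sub>L S" b "w o\<^sub>L T"]
    by eventually_elim (simp add: comb blinfun.bilinear_simps)
qed

lemma represents_zero: "represents 0 (\<lambda>_. 0)"
  using X_linear_combination[of 0 0 0 0] by (simp add: represents_def)

lemma represents_borel_extension:
  fixes T :: "'h \<Rightarrow>\<^sub>L 'v::{banach, second_countable_topology}"
  assumes "represents T Y"
  shows "borel_extension (cyl_image \<theta> T) (distr M borel Y)"
  unfolding borel_extension_def
proof (intro conjI ballI)
  have Y [measurable]: "Y \<in> borel_measurable M"
    using assms by (simp add: represents_def)
  show "prob_space (distr M borel Y)"
    by (rule prob_space_distr) measurable
  show "sets (distr M borel Y) = sets borel" by simp
  fix C :: "'v set" assume "C \<in> cyl_sets UNIV"
  then obtain n vs B where C: "C = cyl_proj n vs -` B" and B: "B \<in> sets (Pi\<^sub>M {..<n} (\<lambda>_. borel :: real measure))"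
    unfolding cyl_sets_def by blast
  have proj [measurable]: "cyl_proj n vs \<in> borel \<rightarrow>\<^sub>M Pi\<^sub>M {..<n} (\<lambda>_. borel)"
    unfolding cyl_proj_def by measurable
  have Cb: "C \<in> sets borel"
    using measurable_sets[OF proj B] by (simp add: C)
  have "AE \<omega> in M. \<forall>i\<in>{..<n}. blinfun_apply (vs i) (Y \<omega>) = X (vs i o\<^sub>L T) \<omega>"
    using assms by (intro AE_finite_allI) (auto simp: represents_def)
  then have "AE \<omega> in M. \<omega> \<in> Y -` C \<inter> space M \<longleftrightarrow>
      \<omega> \<in> {\<omega> \<in> space M. (\<lambda>i\<in>{..<n}. X (vs i o\<^sub>L T) \<omega>) \<in> B}"
  proof eventually_elim
    case (elim \<omega>)
    then have "cyl_proj n vs (Y \<omega>) = (\<lambda>i\<in>{..<n}. X (vs i o\<^sub>L T) \<omega>)"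
      unfolding cyl_proj_def by (intro restrict_ext) auto
    then show ?case by (simp add: C conj_commute)
  qed
  then have "emeasure M (Y -` C \<inter> space M) =
      emeasure M {\<omega> \<in> space M. (\<lambda>i\<in>{..<n}. X (vs i o\<^sub>L T) \<omega>) \<in> B}"
    using measurable_sets[OF Y Cb] joint_event[OF B] by (intro emeasure_eq_AE) auto
  then show "emeasure (distr M borel Y) C = cyl_image \<theta> T C"
    using Cb B by (simp add: emeasure_distr joint_law cyl_image_def C vimage_def cyl_proj_compose)
qed

text \<open>
  The coordinates of the representative along a norming sequence are prescribed, and the measurable
  left inverse assembles them.  That every further functional \<open>w\<close> also takes the prescribed value is a
  statement about the law of the sequence that begins with \<open>w\<close> and goes on with the norming
  functionals, and for the law of that sequence under the Borel extension it is trivial.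
\<close>

lemma exists_representative:
  fixes T :: "'h \<Rightarrow>\<^sub>L 'v::{banach, second_countable_topology}"
  assumes "radonifying \<theta> T"
  shows "\<exists>Y. represents T Y"
proof -
  let ?S = "Pi\<^sub>M UNIV (\<lambda>_. borel) :: (nat \<Rightarrow> real) measure"
  obtain \<mu> where \<mu>: "borel_extension (cyl_image \<theta> T) \<mu>"
    using assms by (auto simp: radonifying_def)
  have [measurable_cong]: "sets \<mu> = sets borel"
    using \<mu> by (simp add: borel_extension_def)
  obtain u :: "nat \<Rightarrow> 'v \<Rightarrow>\<^sub>L real" where "norming_sequence u"
    using exists_norming_sequence by blast
  then obtain K where K [measurable]: "K \<in> ?S \<rightarrow>\<^sub>M borel" and Ku: "\<And>v. K (\<lambda>n. u n v) = v"
    using measurable_recovery_from_coordinates by blast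
  define Y where "Y \<omega> = K (\<lambda>n. X (u n o\<^sub>L T) \<omega>)" for \<omega>
  have "represents T Y"
    unfolding represents_def
  proof (intro conjI allI)
    have "(\<lambda>\<omega> n. X (u n o\<^sub>L T) \<omega>) \<in> M \<rightarrow>\<^sub>M ?S"
      by (auto intro!: measurable_PiM_single')
    then show "Y \<in> borel_measurable M"
      unfolding Y_def by (rule measurable_compose[OF _ K])
    fix w :: "'v \<Rightarrow>\<^sub>L real"
    define c where "c = case_nat w u"
    have X: "(\<lambda>\<omega> i. X (c i o\<^sub>L T) \<omega>) \<in> M \<rightarrow>\<^sub>M ?S"
      by (auto intro!: measurable_PiM_single')
    have c: "(\<lambda>v i. c i v) \<in> \<mu> \<rightarrow>\<^sub>M ?S"
      by (auto intro!: measurable_PiM_single')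
    have eq: "distr M ?S (\<lambda>\<omega> i. X (c i o\<^sub>L T) \<omega>) = distr \<mu> ?S (\<lambda>v i. c i v)"
    proof (rule distr_sequence_eqI)
      fix n and B :: "(nat \<Rightarrow> real) set" assume B: "B \<in> sets (Pi\<^sub>M {..<n} (\<lambda>_. borel))"
      show "emeasure M {\<omega> \<in> space M. (\<lambda>i\<in>{..<n}. X (c i o\<^sub>L T) \<omega>) \<in> B} =
          emeasure \<mu> {v \<in> space \<mu>. (\<lambda>i\<in>{..<n}. blinfun_apply (c i) v) \<in> B}"
        using B by (simp add: joint_law borel_extension_emeasure[OF \<mu>] cyl_image_def vimage_def cyl_proj_compose)
    qed (auto intro: finite_measure_axioms)
    have shift [measurable]: "(\<lambda>x n. x (Suc n)) \<in> ?S \<rightarrow>\<^sub>M ?S"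
      by (auto intro!: measurable_PiM_single')
    have E: "Measurable.pred ?S (\<lambda>x. blinfun_apply w (K (\<lambda>n. x (Suc n))) = x 0)"
    proof -
      have "(\<lambda>x. blinfun_apply w (K (\<lambda>n. x (Suc n)))) \<in> borel_measurable ?S"
        by (intro measurable_compose[OF shift measurable_compose[OF K]]) measurable
      then show ?thesis unfolding pred_def by (rule borel_measurable_eq) measurable
    qed
    have "AE x in distr \<mu> ?S (\<lambda>v i. c i v). blinfun_apply w (K (\<lambda>n. x (Suc n))) = x 0"
      using E by (subst AE_distr_iff[OF c]) (auto simp: c_def Ku pred_def)
    then have "AE x in distr M ?S (\<lambda>\<omega> i. X (c i o\<^sub>L T) \<omega>). blinfun_apply w (K (\<lambda>n. x (Suc n))) = x 0"
      by (simp only: eq)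
    then show "AE \<omega> in M. blinfun_apply w (Y \<omega>) = X (w o\<^sub>L T) \<omega>"
      using E by (subst (asm) AE_distr_iff[OF X]) (auto simp: c_def Y_def pred_def)
  qed
  then show ?thesis by blast
qed

lemma represents_image_law:
  fixes T :: "'h \<Rightarrow>\<^sub>L 'v::{banach, second_countable_topology}"
  assumes "represents T Y"
  shows "radonifying \<theta> T" "image_law \<theta> T = distr M borel Y"
  using represents_borel_extension[OF assms] image_law_eqI by (auto simp: radonifying_def)

end

section \<open>Continuity of the random functional\<close>

text \<open>
  All the fractions of \<open>x\<close> are multiples of \<open>2 * pi\<close>, and eventually they are too small to be nonzero
  multiples.
\<close>

lemma eq_zero_if_cos_fractions_eq_1:
  fixes x :: real
  assumes "\<And>n. cos (x / real (Suc n)) = 1"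
  shows "x = 0"
proof -
  obtain n where n: "\<bar>x\<bar> < real n" using reals_Archimedean2 by blast
  obtain m :: int where m: "x / real (Suc n) = m * 2 * pi"
    using assms[of n] by (auto simp: cos_one_2pi_int)
  have "\<bar>x / real (Suc n)\<bar> < 1" using n by simp
  moreover have "\<bar>x / real (Suc n)\<bar> = \<bar>real_of_int m\<bar> * (2 * pi)"
    unfolding m by (simp add: abs_mult)
  ultimately have small: "\<bar>real_of_int m\<bar> * (2 * pi) < 1" by (simp only:)
  have "m = 0"
  proof (rule ccontr)
    assume "m \<noteq> 0"
    then have "1 \<le> \<bar>real_of_int m\<bar>" by linarith
    then have "1 * (2 * pi) \<le> \<bar>real_of_int m\<bar> * (2 * pi)"
      by (intro mult_right_mono) auto
    then show False using small pi_gt3 by linarith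
  qed
  then show ?thesis using m by simp
qed

context cylindrical_process
begin

text \<open>
  The difference of the limit and \<open>X w\<close> has a trivial characteristic function: by dominated
  convergence its value at \<open>t\<close> is the limit of \<open>cyl_char \<theta> (t *\<^sub>R (v k - w))\<close>, which is
  \<open>cyl_char \<theta> 0 = 1\<close> by continuity.  So the difference vanishes almost surely.
\<close>

lemma AE_limit_of_X:
  assumes cont: "continuous_on UNIV (cyl_char \<theta>)"
    and v: "v \<longlonglongrightarrow> w"
    and [measurable]: "\<zeta> \<in> borel_measurable M"
    and lim: "AE \<omega> in M. (\<lambda>k. X (v k) \<omega>) \<longlonglongrightarrow> \<zeta> \<omega>"
  shows "AE \<omega> in M. \<zeta> \<omega> = X w \<omega>"
proof -
  have "AE \<omega> in M. cos (t * (\<zeta> \<omega> - X w \<omega>)) = 1" for t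
  proof -
    let ?e = "\<lambda>y. exp (\<i> * complex_of_real y)"
    have X_diff: "AE \<omega> in M. \<forall>k. X (t *\<^sub>R (v k - w)) \<omega> = t * (X (v k) \<omega> - X w \<omega>)"
      unfolding AE_all_countable
    proof
      fix k
      show "AE \<omega> in M. X (t *\<^sub>R (v k - w)) \<omega> = t * (X (v k) \<omega> - X w \<omega>)"
        using X_linear_combination[of t "v k" "- t" w] by (simp add: algebra_simps)
    qed
    have lim1: "(\<lambda>k. LINT \<omega>|M. ?e (X (t *\<^sub>R (v k - w)) \<omega>)) \<longlonglongrightarrow> (LINT \<omega>|M. ?e (t * (\<zeta> \<omega> - X w \<omega>)))"
    proof (rule integral_dominated_convergence)
      show "AE \<omega> in M. (\<lambda>k. ?e (X (t *\<^sub>R (v k - w)) \<omega>)) \<longlonglongrightarrow> ?e (t * (\<zeta> \<omega> - X w \<omega>))"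
        using X_diff lim
      proof eventually_elim
        case (elim \<omega>)
        then show ?case by (auto intro!: tendsto_intros)
      qed
      show "integrable M (\<lambda>_. 1 :: real)" by simp
    qed (simp_all, measurable)
    have lim2: "(\<lambda>k. LINT \<omega>|M. ?e (X (t *\<^sub>R (v k - w)) \<omega>)) \<longlonglongrightarrow> cyl_char \<theta> 0"
    proof -
      have "(\<lambda>k. t *\<^sub>R (v k - w)) \<longlonglongrightarrow> t *\<^sub>R (w - w)"
        by (intro tendsto_intros v)
      then have "(\<lambda>k. cyl_char \<theta> (t *\<^sub>R (v k - w))) \<longlonglongrightarrow> cyl_char \<theta> 0"
        by (intro continuous_on_tendsto_compose[OF cont]) auto
      then show ?thesis by (simp only: expectation_exp_X)
    qed
    have "cyl_char \<theta> 0 = 1"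
    proof -
      have "AE \<omega> in M. X 0 \<omega> = 0"
        using X_linear_combination[of 0 0 0 0] by simp
      then have "(LINT \<omega>|M. ?e (X 0 \<omega>)) = (LINT \<omega>|M. 1)"
        by (intro integral_cong_AE) auto
      then show ?thesis by (simp add: expectation_exp_X prob_space)
    qed
    then have e1: "(LINT \<omega>|M. ?e (t * (\<zeta> \<omega> - X w \<omega>))) = 1"
      using LIMSEQ_unique[OF lim1 lim2] by simp
    have int: "integrable M (\<lambda>\<omega>. ?e (t * (\<zeta> \<omega> - X w \<omega>)))"
      by (rule integrable_const_bound[of _ 1]) simp_all
    have "(LINT \<omega>|M. cos (t * (\<zeta> \<omega> - X w \<omega>))) = (LINT \<omega>|M. Re (?e (t * (\<zeta> \<omega> - X w \<omega>))))"
      by (simp add: Re_exp)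
    also have "\<dots> = 1"
      using integral_Re[OF int] e1 by simp
    finally have cos1: "(LINT \<omega>|M. cos (t * (\<zeta> \<omega> - X w \<omega>))) = 1" .
    have int_cos: "integrable M (\<lambda>\<omega>. cos (t * (\<zeta> \<omega> - X w \<omega>)))"
      by (rule integrable_const_bound[of _ 1]) simp_all
    then have "(LINT \<omega>|M. 1 - cos (t * (\<zeta> \<omega> - X w \<omega>))) = 0"
      by (simp add: cos1 prob_space)
    then have "AE \<omega> in M. 1 - cos (t * (\<zeta> \<omega> - X w \<omega>)) = 0"
      using int_cos by (subst (asm) integral_nonneg_eq_0_iff_AE) auto
    then show ?thesis by simp
  qed
  then have "AE \<omega> in M. \<forall>n. cos ((1 / real (Suc n)) * (\<zeta> \<omega> - X w \<omega>)) = 1"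
    unfolding AE_all_countable by blast
  then show ?thesis
  proof eventually_elim
    case (elim \<omega>)
    then have "\<zeta> \<omega> - X w \<omega> = 0"
      by (intro eq_zero_if_cos_fractions_eq_1) simp
    then show ?case by simp
  qed
qed

text \<open>
  Convergence of operators gives convergence of the functionals \<open>w o\<^sub>L T k\<close> in norm, and continuity of
  the characteristic function passes it on to the process.
\<close>

lemma represents_limit:
  fixes T :: "nat \<Rightarrow> 'h \<Rightarrow>\<^sub>L 'v::{banach, second_countable_topology}"
  assumes cont: "continuous_on UNIV (cyl_char \<theta>)"
    and T: "T \<longlonglongrightarrow> L" and Y: "\<And>k. represents (T k) (Y k)"
    and Z: "Z \<in> borel_measurable M" and lim: "AE \<omega> in M. (\<lambda>k. Y k \<omega>) \<longlonglongrightarrow> Z \<omega>"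
  shows "represents L Z"
  unfolding represents_def
proof (intro conjI allI Z)
  fix w :: "'v \<Rightarrow>\<^sub>L real"
  have "(\<lambda>k. w o\<^sub>L T k) \<longlonglongrightarrow> (w o\<^sub>L L)"
    by (intro bounded_bilinear.tendsto[OF bounded_bilinear_blinfun_compose] tendsto_const T)
  moreover have "(\<lambda>\<omega>. blinfun_apply w (Z \<omega>)) \<in> borel_measurable M"
    using Z by measurable
  moreover have "AE \<omega> in M. (\<lambda>k. X (w o\<^sub>L T k) \<omega>) \<longlonglongrightarrow> blinfun_apply w (Z \<omega>)"
  proof -
    have "AE \<omega> in M. \<forall>k. blinfun_apply w (Y k \<omega>) = X (w o\<^sub>L T k) \<omega>"
      using Y by (auto simp: AE_all_countable represents_def)
    then show ?thesis
      using lim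
    proof eventually_elim
      case (elim \<omega>)
      then have "(\<lambda>k. blinfun_apply w (Y k \<omega>)) \<longlonglongrightarrow> blinfun_apply w (Z \<omega>)"
        by (intro blinfun.tendsto tendsto_const)
      then show ?case using elim(1) by simp
    qed
  qed
  ultimately show "AE \<omega> in M. blinfun_apply w (Z \<omega>) = X (w o\<^sub>L L) \<omega>"
    by (rule AE_limit_of_X[OF cont])
qed

end

section \<open>Lebesgue spaces of vector-valued functions\<close>

definition Lp_norm :: "'a measure \<Rightarrow> real \<Rightarrow> ('a \<Rightarrow> 'b::real_normed_vector) \<Rightarrow> real" where
  "Lp_norm M p f = (LINT x|M. norm (f x) powr p) powr (1 / p)"

lemma Lp_norm_nonneg [simp]: "0 \<le> Lp_norm M p f"
  by (simp add: Lp_norm_def)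

lemma Lp_norm_le_iff:
  assumes "0 < p" "0 \<le> a"
  shows "Lp_norm M p f \<le> a \<longleftrightarrow> (LINT x|M. norm (f x) powr p) \<le> a powr p"
proof -
  have nn: "0 \<le> (LINT x|M. norm (f x) powr p)" by simp
  have "Lp_norm M p f \<le> a \<longleftrightarrow> Lp_norm M p f powr p \<le> a powr p"
    using assms powr_mono2[of p "Lp_norm M p f" a] powr_less_mono2[of p a "Lp_norm M p f"]
    by (auto simp: not_le[symmetric])
  also have "Lp_norm M p f powr p = (LINT x|M. norm (f x) powr p)"
    using assms nn by (simp add: Lp_norm_def powr_powr)
  finally show ?thesis .
qed

lemma Lp_norm_scaleR:
  assumes "0 < p"
  shows "Lp_norm M p (\<lambda>x. c *\<^sub>R f x) = \<bar>c\<bar> * Lp_norm M p f"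
  using assms by (simp add: Lp_norm_def powr_mult powr_powr)

text \<open>
  Convexity of \<open>x powr p\<close> on the closed half-line, with the weights that prove the Minkowski
  inequality.  Where \<open>x\<close> or \<open>y\<close> vanishes, it reduces to \<open>c powr p \<le> c\<close> for a weight \<open>c \<le> 1\<close>.
\<close>

lemma powr_weighted_mean_le:
  fixes x y a b p :: real
  assumes "1 \<le> p" "0 \<le> x" "0 \<le> y" "0 < a" "0 < b"
  shows "((x + y) / (a + b)) powr p \<le> a / (a + b) * (x / a) powr p + b / (a + b) * (y / b) powr p"
proof -
  have one: "(c * z) powr p \<le> c * z powr p" if "0 \<le> c" "c \<le> 1" "0 \<le> z" for c z
  proof -
    have "c powr p \<le> c"
      using powr_mono'[of 1 p c] that assms(1) by simp
    then show ?thesis using that by (simp add: powr_mult mult_right_mono)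
  qed
  consider "x = 0" | "y = 0" | "0 < x" "0 < y" using assms by linarith
  then show ?thesis
  proof cases
    case 1
    then show ?thesis using one[of "b / (a + b)" "y / b"] assms by simp
  next
    case 2
    then show ?thesis using one[of "a / (a + b)" "x / a"] assms by simp
  next
    case 3
    have "1 - b / (a + b) = a / (a + b)"
      using assms by (simp add: field_simps)
    moreover have "(a / (a + b)) *\<^sub>R (x / a) + (b / (a + b)) *\<^sub>R (y / b) = (x + y) / (a + b)"
      using assms by (simp add: add_divide_distrib)
    ultimately show ?thesis
      using convex_onD[OF powr_convex[OF assms(1)], of "b / (a + b)" "x / a" "y / b"] 3 assms by simp
  qed
qed

lemma integrable_norm_powr_add:
  fixes f g :: "'a \<Rightarrow> 'b::{banach, second_countable_topology}"
  assumes p: "1 \<le> p"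
    and [measurable]: "f \<in> borel_measurable M" "g \<in> borel_measurable M"
    and int: "integrable M (\<lambda>x. norm (f x) powr p)" "integrable M (\<lambda>x. norm (g x) powr p)"
  shows "integrable M (\<lambda>x. norm (f x + g x) powr p)"
proof (rule Bochner_Integration.integrable_bound)
  show "integrable M (\<lambda>x. 2 powr p * (norm (f x) powr p + norm (g x) powr p))"
    using int by simp
  have "norm (f x + g x) powr p \<le> 2 powr p * (norm (f x) powr p + norm (g x) powr p)" for x
  proof -
    have "norm (f x + g x) powr p \<le> (2 * max (norm (f x)) (norm (g x))) powr p"
      using p norm_triangle_ineq[of "f x" "g x"] by (intro powr_mono2) auto
    also have "\<dots> = 2 powr p * max (norm (f x)) (norm (g x)) powr p"
      by (simp add: powr_mult le_max_iff_disj)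
    also have "max (norm (f x)) (norm (g x)) powr p \<le> norm (f x) powr p + norm (g x) powr p"
      by (simp add: max_def)
    finally show ?thesis by simp
  qed
  then show "AE x in M. norm (norm (f x + g x) powr p) \<le> norm (2 powr p * (norm (f x) powr p + norm (g x) powr p))"
    by auto
qed measurable

text \<open>
  Normalise both summands by slightly more than their norms and integrate the pointwise convexity
  estimate.
\<close>

lemma Lp_norm_triangle_ineq:
  fixes f g :: "'a \<Rightarrow> 'b::{banach, second_countable_topology}"
  assumes p: "1 \<le> p"
    and [measurable]: "f \<in> borel_measurable M" "g \<in> borel_measurable M"
    and int: "integrable M (\<lambda>x. norm (f x) powr p)" "integrable M (\<lambda>x. norm (g x) powr p)"
  shows "Lp_norm M p (\<lambda>x. f x + g x) \<le> Lp_norm M p f + Lp_norm M p g"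
proof (rule field_le_epsilon)
  fix e :: real assume e: "0 < e"
  \<comment> \<open>The extra \<open>e / 2\<close> keeps the divisors positive when a norm vanishes.\<close>
  define a where "a = Lp_norm M p f + e / 2"
  define b where "b = Lp_norm M p g + e / 2"
  have ab: "0 < a" "0 < b"
    using e Lp_norm_nonneg[of M p f] Lp_norm_nonneg[of M p g] by (auto simp: a_def b_def intro: add_nonneg_pos)
  let ?F = "LINT x|M. norm (f x) powr p" and ?G = "LINT x|M. norm (g x) powr p"
  let ?h = "\<lambda>x. (a + b) powr p * (a / (a + b) * (norm (f x) powr p / a powr p) + b / (a + b) * (norm (g x) powr p / b powr p))"
  have "norm (f x + g x) powr p \<le> ?h x" for x
  proof -
    have "norm (f x + g x) powr p \<le> (norm (f x) + norm (g x)) powr p"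
      using p norm_triangle_ineq by (intro powr_mono2) auto
    also have "\<dots> = (a + b) powr p * ((norm (f x) + norm (g x)) / (a + b)) powr p"
      using ab by (simp add: powr_divide)
    also have "\<dots> \<le> ?h x"
      using powr_weighted_mean_le[OF p, of "norm (f x)" "norm (g x)" a b] ab
      by (intro mult_left_mono) (auto simp: powr_divide)
    finally show ?thesis .
  qed
  then have "(LINT x|M. norm (f x + g x) powr p) \<le> (LINT x|M. ?h x)"
    using int by (intro integral_mono integrable_norm_powr_add p) auto
  also have "\<dots> = (a + b) powr p * (a / (a + b) * (?F / a powr p) + b / (a + b) * (?G / b powr p))"
    using int by simp
  also have "\<dots> \<le> (a + b) powr p * (a / (a + b) * 1 + b / (a + b) * 1)"
  proof -
    have "?F \<le> a powr p" "?G \<le> b powr p"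
      using Lp_norm_le_iff[of p a M f] Lp_norm_le_iff[of p b M g] p e ab by (auto simp: a_def b_def)
    then show ?thesis
      using ab by (intro mult_left_mono add_mono) auto
  qed
  also have "\<dots> = (a + b) powr p"
    using ab by (simp add: add_divide_distrib[symmetric])
  finally have "Lp_norm M p (\<lambda>x. f x + g x) \<le> a + b"
    using p ab by (subst Lp_norm_le_iff) auto
  then show "Lp_norm M p (\<lambda>x. f x + g x) \<le> Lp_norm M p f + Lp_norm M p g + e"
    by (simp add: a_def b_def)
qed

text \<open>
  Integrated over a probability space, with \<open>a\<close> a bound for the norm of order \<open>p\<close>, this bounds the
  first moment by \<open>2 * a\<close>.
\<close>

lemma le_add_powr:
  fixes a x p :: real
  assumes "1 \<le> p" "0 < a" "0 \<le> x"
  shows "x \<le> a + a powr (1 - p) * x powr p"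
proof (cases "x \<le> a")
  case True
  then show ?thesis by (simp add: add_increasing2)
next
  case False
  then have x: "0 < x" "a \<le> x" using assms by auto
  have "x = x powr (1 - p) * x powr p"
    using x by (simp add: powr_add[symmetric])
  also have "\<dots> \<le> a powr (1 - p) * x powr p"
    using x assms by (intro mult_right_mono powr_mono2') auto
  finally show ?thesis using assms by simp
qed

lemma (in prob_space) nn_integral_norm_le:
  fixes f :: "'a \<Rightarrow> 'b::{banach, second_countable_topology}"
  assumes p: "1 \<le> p" and a: "0 < a" and [measurable]: "f \<in> borel_measurable M"
    and int: "integrable M (\<lambda>x. norm (f x) powr p)" and le: "Lp_norm M p f \<le> a"
  shows "(\<integral>\<^sup>+x. ennreal (norm (f x)) \<partial>M) \<le> ennreal (2 * a)"
proof -
  have "(\<integral>\<^sup>+x. ennreal (norm (f x)) \<partial>M) \<le> (\<integral>\<^sup>+x. ennreal (a + a powr (1 - p) * norm (f x) powr p) \<partial>M)"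
    using p a by (intro nn_integral_mono ennreal_leI le_add_powr) auto
  also have "\<dots> = ennreal (LINT x|M. a + a powr (1 - p) * norm (f x) powr p)"
    using int a by (intro nn_integral_eq_integral) auto
  also have "(LINT x|M. a + a powr (1 - p) * norm (f x) powr p) = a + a powr (1 - p) * (LINT x|M. norm (f x) powr p)"
    using int by (simp add: prob_space)
  also have "\<dots> \<le> a + a powr (1 - p) * a powr p"
    using le p a Lp_norm_le_iff[of p a M f] by (intro add_left_mono mult_left_mono) auto
  also have "\<dots> = 2 * a"
    using a by (simp add: powr_add[symmetric])
  finally show ?thesis by (simp add: ennreal_leI)
qed

lemma convergent_of_summable_norm_diff:
  fixes f :: "nat \<Rightarrow> 'b::banach"
  assumes "summable (\<lambda>k. norm (f (Suc k) - f k))"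
  shows "convergent f"
proof -
  have "(\<lambda>m. \<Sum>k<m. f (Suc k) - f k) \<longlonglongrightarrow> (\<Sum>k. f (Suc k) - f k)"
    using summable_norm_cancel[OF assms] by (rule summable_LIMSEQ)
  then have "(\<lambda>m. f m - f 0) \<longlonglongrightarrow> (\<Sum>k. f (Suc k) - f k)"
    by (simp add: sum_lessThan_telescope)
  then have "(\<lambda>m. f m - f 0 + f 0) \<longlonglongrightarrow> (\<Sum>k. f (Suc k) - f k) + f 0"
    by (intro tendsto_intros)
  then show ?thesis by (auto simp: convergent_def)
qed

text \<open>
  The function \<open>d\<close> stands for the seminorm of the difference of two terms, which is not a metric on
  any type at hand.
\<close>

lemma Cauchy_rapid_subsequence:
  fixes d :: "nat \<Rightarrow> nat \<Rightarrow> real"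
  assumes "\<And>e. 0 < e \<Longrightarrow> \<exists>N. \<forall>m\<ge>N. \<forall>n\<ge>N. d m n < e"
  shows "\<exists>r. strict_mono r \<and> (\<forall>k. d (r (Suc k)) (r k) < (1 / 2) ^ k)"
proof -
  have "\<exists>N. \<forall>m\<ge>N. \<forall>n\<ge>N. d m n < (1 / 2) ^ k" for k
    by (rule assms) simp
  then obtain N where N: "\<And>k m n. N k \<le> m \<Longrightarrow> N k \<le> n \<Longrightarrow> d m n < (1 / 2) ^ k"
    by metis
  \<comment> \<open>The sum dominates \<open>N k\<close> and grows with \<open>k\<close>; the summand \<open>k\<close> makes it strictly increasing.\<close>
  define r where "r k = k + (\<Sum>i\<le>k. N i)" for k
  have "N k \<le> r k" for k
    unfolding r_def by (rule trans_le_add2) (rule member_le_sum, auto)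
  moreover have "strict_mono r"
    unfolding r_def by (auto simp: strict_mono_Suc_iff)
  moreover have "r k \<le> r (Suc k)" for k
    by (simp add: r_def)
  ultimately show ?thesis
    by (intro exI[of _ r] conjI allI N) (auto intro: order_trans)
qed

text \<open>
  The Riesz-Fischer theorem for vector-valued functions.  Along a rapidly converging subsequence the
  expected sum of the increments is finite, so the subsequence converges almost surely; Fatou's lemma
  then bounds the distance of each late term to the limit by the Cauchy modulus.  The almost surely
  convergent subsequence is part of the conclusion, because the limit has to be identified pointwise.
\<close>

lemma (in prob_space) Lp_Cauchy_convergent:
  fixes f :: "nat \<Rightarrow> 'a \<Rightarrow> 'b::{banach, second_countable_topology}"
  assumes p: "1 \<le> p"
    and f [measurable]: "\<And>n. f n \<in> borel_measurable M"
    and int: "\<And>n. integrable M (\<lambda>x. norm (f n x) powr p)"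
    and Cauchy: "\<And>e. 0 < e \<Longrightarrow> \<exists>N. \<forall>m\<ge>N. \<forall>n\<ge>N. Lp_norm M p (\<lambda>x. f m x - f n x) < e"
  obtains r g where "strict_mono r" "g \<in> borel_measurable M" "AE x in M. (\<lambda>k. f (r k) x) \<longlonglongrightarrow> g x"
    "integrable M (\<lambda>x. norm (g x) powr p)" "(\<lambda>n. Lp_norm M p (\<lambda>x. f n x - g x)) \<longlonglongrightarrow> 0"
proof -
  have int_diff: "integrable M (\<lambda>x. norm (f m x - f n x) powr p)" for m n
    using integrable_norm_powr_add[OF p, of "f m" M "\<lambda>x. - f n x"] int by simp
  obtain r where r: "strict_mono r"
    and rapid: "\<And>k. Lp_norm M p (\<lambda>x. f (r (Suc k)) x - f (r k) x) < (1 / 2) ^ k"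
    using Cauchy_rapid_subsequence[OF Cauchy] by blast
  define g where "g x = lim (\<lambda>k. f (r k) x)" for x
  have g [measurable]: "g \<in> borel_measurable M"
    unfolding g_def by (intro borel_measurable_lim_metric) simp
  have lim: "AE x in M. (\<lambda>k. f (r k) x) \<longlonglongrightarrow> g x"
  proof -
    have "(\<integral>\<^sup>+x. (\<Sum>k. ennreal (norm (f (r (Suc k)) x - f (r k) x))) \<partial>M)
        = (\<Sum>k. \<integral>\<^sup>+x. ennreal (norm (f (r (Suc k)) x - f (r k) x)) \<partial>M)"
      by (intro nn_integral_suminf) measurable
    also have "\<dots> \<le> (\<Sum>k. ennreal (2 * (1 / 2) ^ k))"
    proof (intro suminf_le summableI)
      show "(\<integral>\<^sup>+x. ennreal (norm (f (r (Suc k)) x - f (r k) x)) \<partial>M) \<le> ennreal (2 * (1 / 2) ^ k)" for k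
        by (rule nn_integral_norm_le[OF p _ _ int_diff less_imp_le[OF rapid]]) simp_all
    qed
    also have "\<dots> < \<infinity>"
    proof -
      have "summable (\<lambda>k. 2 * (1 / 2 :: real) ^ k)" by (intro summable_mult summable_geometric) simp
      then show ?thesis
        by (simp add: suminf_ennreal2)
    qed
    finally have "AE x in M. (\<Sum>k. ennreal (norm (f (r (Suc k)) x - f (r k) x))) \<noteq> \<infinity>"
      by (intro nn_integral_PInf_AE) auto
    then show ?thesis
    proof eventually_elim
      case (elim x)
      then have "summable (\<lambda>k. norm (f (r (Suc k)) x - f (r k) x))"
        by (intro summable_suminf_not_top) auto
      then have "convergent (\<lambda>k. f (r k) x)"
        by (rule convergent_of_summable_norm_diff)
      then show ?case by (simp add: g_def convergent_LIMSEQ_iff)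
    qed
  qed
  have tail: "integrable M (\<lambda>x. norm (f n x - g x) powr p) \<and> Lp_norm M p (\<lambda>x. f n x - g x) \<le> e"
    if e: "0 < e" and N: "\<forall>m\<ge>N. \<forall>n\<ge>N. Lp_norm M p (\<lambda>x. f m x - f n x) < e" and n: "N \<le> n" for e N n
  proof -
    have "(\<integral>\<^sup>+x. ennreal (norm (f n x - g x) powr p) \<partial>M)
        = (\<integral>\<^sup>+x. liminf (\<lambda>k. ennreal (norm (f n x - f (r k) x) powr p)) \<partial>M)"
    proof (rule nn_integral_cong_AE)
      show "AE x in M. ennreal (norm (f n x - g x) powr p) = liminf (\<lambda>k. ennreal (norm (f n x - f (r k) x) powr p))"
        using lim
      proof eventually_elim
        case (elim x)
        then have "(\<lambda>k. ennreal (norm (f n x - f (r k) x) powr p)) \<longlonglongrightarrow> ennreal (norm (f n x - g x) powr p)"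
          using p by (intro tendsto_ennrealI tendsto_powr' tendsto_norm tendsto_diff tendsto_const) auto
        from lim_imp_Liminf[OF trivial_limit_sequentially this] show ?case by (rule sym)
      qed
    qed
    also have "\<dots> \<le> liminf (\<lambda>k. \<integral>\<^sup>+x. ennreal (norm (f n x - f (r k) x) powr p) \<partial>M)"
      by (intro nn_integral_liminf) measurable
    also have "\<dots> \<le> ennreal (e powr p)"
    proof (rule Liminf_le)
      show "\<forall>\<^sub>F k in sequentially. (\<integral>\<^sup>+x. ennreal (norm (f n x - f (r k) x) powr p) \<partial>M) \<le> ennreal (e powr p)"
        using eventually_ge_at_top[of N]
      proof eventually_elim
        case (elim k)
        have "Lp_norm M p (\<lambda>x. f n x - f (r k) x) \<le> e"
          using N n seq_suble[OF r, of k] elim by (intro less_imp_le) auto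
        then show ?case
          using p e by (simp add: nn_integral_eq_integral[OF int_diff] Lp_norm_le_iff ennreal_leI)
      qed
    qed simp
    finally have le: "(\<integral>\<^sup>+x. ennreal (norm (f n x - g x) powr p) \<partial>M) \<le> ennreal (e powr p)" .
    then have int': "integrable M (\<lambda>x. norm (f n x - g x) powr p)"
      by (intro integrableI_bounded) (auto simp: less_top[symmetric] top_unique intro: le_less_trans)
    then show ?thesis
      using le p e by (simp add: nn_integral_eq_integral Lp_norm_le_iff)
  qed
  have "integrable M (\<lambda>x. norm (g x) powr p)"
  proof -
    obtain N where "\<forall>m\<ge>N. \<forall>n\<ge>N. Lp_norm M p (\<lambda>x. f m x - f n x) < 1"
      using Cauchy[of 1] by auto
    then have "integrable M (\<lambda>x. norm (f N x - g x) powr p)"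
      using tail[of 1 N N] by simp
    then have "integrable M (\<lambda>x. norm (f N x + - (f N x - g x)) powr p)"
      using int[of N] by (intro integrable_norm_powr_add p) (auto simp: norm_minus_commute)
    then show ?thesis by simp
  qed
  moreover have "(\<lambda>n. Lp_norm M p (\<lambda>x. f n x - g x)) \<longlonglongrightarrow> 0"
  proof (rule LIMSEQ_I)
    fix e :: real assume e: "0 < e"
    obtain N where "\<forall>m\<ge>N. \<forall>n\<ge>N. Lp_norm M p (\<lambda>x. f m x - f n x) < e / 2"
      using Cauchy[of "e / 2"] e by auto
    then have "Lp_norm M p (\<lambda>x. f n x - g x) \<le> e / 2" if "N \<le> n" for n
      using tail[of "e / 2" N n] e that by simp
    then show "\<exists>N. \<forall>n\<ge>N. norm (Lp_norm M p (\<lambda>x. f n x - g x) - 0) < e"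
      using e by (intro exI[of _ N]) force
  qed
  ultimately show ?thesis using that r g lim by blast
qed

section \<open>The Banach space of radonifying operators\<close>

context cylindrical_process
begin

lemma radonifying_space_iff:
  fixes T :: "'h \<Rightarrow>\<^sub>L 'v::{banach, second_countable_topology}"
  shows "T \<in> radonifying_space \<theta> p \<longleftrightarrow>
    (\<exists>Y. represents T Y \<and> integrable M (\<lambda>\<omega>. norm (Y \<omega>) powr p))"
proof -
  have "(\<integral>\<^sup>+ v. ennreal (norm v powr p) \<partial>image_law \<theta> T) < \<infinity> \<longleftrightarrow>
      integrable M (\<lambda>\<omega>. norm (Y \<omega>) powr p)" if Y: "represents T Y" for Y
  proof -
    have [measurable]: "Y \<in> borel_measurable M"
      using Y by (simp add: represents_def)
    have "(\<integral>\<^sup>+ v. ennreal (norm v powr p) \<partial>image_law \<theta> T) = (\<integral>\<^sup>+ \<omega>. ennreal (norm (Y \<omega>) powr p) \<partial>M)"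
      unfolding represents_image_law(2)[OF Y] by (intro nn_integral_distr) measurable
    then show ?thesis
      by (simp add: integrable_iff_bounded)
  qed
  then show ?thesis
    using exists_representative[of T] represents_image_law(1)
    unfolding radonifying_space_def by blast
qed

lemma radonifying_norm_eq:
  fixes T :: "'h \<Rightarrow>\<^sub>L 'v::{banach, second_countable_topology}"
  assumes Y: "represents T Y"
  shows "radonifying_norm \<theta> p T = Lp_norm M p Y + norm T"
proof -
  have [measurable]: "Y \<in> borel_measurable M"
    using Y by (simp add: represents_def)
  have "(LINT v|image_law \<theta> T. norm v powr p) = (LINT \<omega>|M. norm (Y \<omega>) powr p)"
    unfolding represents_image_law(2)[OF Y] by (intro integral_distr) measurable
  then show ?thesis by (simp add: radonifying_norm_def Lp_norm_def)
qed

lemma radonifying_spaceE: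
  fixes T :: "'h \<Rightarrow>\<^sub>L 'v::{banach, second_countable_topology}"
  assumes "T \<in> radonifying_space \<theta> p"
  obtains Y where "represents T Y" "Y \<in> borel_measurable M" "integrable M (\<lambda>\<omega>. norm (Y \<omega>) powr p)"
  using assms unfolding radonifying_space_iff by (auto simp: represents_def)

lemma subspace_radonifying_space:
  assumes p: "1 \<le> p"
  shows "subspace (radonifying_space \<theta> p :: ('h \<Rightarrow>\<^sub>L 'v::{banach, second_countable_topology}) set)"
proof (rule subspaceI)
  show "(0 :: 'h \<Rightarrow>\<^sub>L 'v) \<in> radonifying_space \<theta> p"
    unfolding radonifying_space_iff by (intro exI[of _ "\<lambda>_. 0"]) (simp add: represents_zero)
next
  fix S T :: "'h \<Rightarrow>\<^sub>L 'v"
  assume "S \<in> radonifying_space \<theta> p" "T \<in> radonifying_space \<theta> p"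
  then obtain Y Z where "represents S Y" "represents T Z"
    and "Y \<in> borel_measurable M" "Z \<in> borel_measurable M"
    and "integrable M (\<lambda>\<omega>. norm (Y \<omega>) powr p)" "integrable M (\<lambda>\<omega>. norm (Z \<omega>) powr p)"
    by (elim radonifying_spaceE)
  then show "S + T \<in> radonifying_space \<theta> p"
    unfolding radonifying_space_iff
    using represents_linear_combination[of S Y T Z 1 1] integrable_norm_powr_add[OF p, of Y M Z]
    by (intro exI[of _ "\<lambda>\<omega>. Y \<omega> + Z \<omega>"]) simp
next
  fix c and T :: "'h \<Rightarrow>\<^sub>L 'v"
  assume "T \<in> radonifying_space \<theta> p"
  then obtain Y where "represents T Y" "integrable M (\<lambda>\<omega>. norm (Y \<omega>) powr p)"
    by (elim radonifying_spaceE)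
  then show "c *\<^sub>R T \<in> radonifying_space \<theta> p"
    unfolding radonifying_space_iff
    using represents_linear_combination[of T Y T Y c 0]
    by (intro exI[of _ "\<lambda>\<omega>. c *\<^sub>R Y \<omega>"]) (simp add: powr_mult)
qed

lemma norm_on_radonifying_space:
  assumes p: "1 \<le> p"
  shows "norm_on (radonifying_space \<theta> p :: ('h \<Rightarrow>\<^sub>L 'v::{banach, second_countable_topology}) set)
    (radonifying_norm \<theta> p)"
  unfolding norm_on_def
proof (intro conjI ballI allI)
  fix T :: "'h \<Rightarrow>\<^sub>L 'v" assume "T \<in> radonifying_space \<theta> p"
  then obtain Y where Y: "represents T Y"
    by (elim radonifying_spaceE)
  show "0 \<le> radonifying_norm \<theta> p T"
    by (simp add: radonifying_norm_eq[OF Y])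
  show "radonifying_norm \<theta> p T = 0 \<longleftrightarrow> T = 0"
  proof
    assume "radonifying_norm \<theta> p T = 0"
    then have "norm T \<le> 0"
      using Lp_norm_nonneg[of M p Y] unfolding radonifying_norm_eq[OF Y] by linarith
    then show "T = 0" by simp
  next
    assume "T = 0"
    then show "radonifying_norm \<theta> p T = 0"
      by (simp add: radonifying_norm_eq[OF represents_zero] Lp_norm_def)
  qed
next
  fix c and T :: "'h \<Rightarrow>\<^sub>L 'v" assume "T \<in> radonifying_space \<theta> p"
  then obtain Y where Y: "represents T Y"
    by (elim radonifying_spaceE)
  have cY: "represents (c *\<^sub>R T) (\<lambda>\<omega>. c *\<^sub>R Y \<omega>)"
    using represents_linear_combination[OF Y Y, of c 0] by simp
  show "radonifying_norm \<theta> p (c *\<^sub>R T) = \<bar>c\<bar> * radonifying_norm \<theta> p T"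
    unfolding radonifying_norm_eq[OF Y] radonifying_norm_eq[OF cY]
    using p by (simp add: Lp_norm_scaleR distrib_left)
next
  fix S T :: "'h \<Rightarrow>\<^sub>L 'v"
  assume "S \<in> radonifying_space \<theta> p" "T \<in> radonifying_space \<theta> p"
  then obtain Y Z where YZ: "represents S Y" "represents T Z"
    and "Y \<in> borel_measurable M" "Z \<in> borel_measurable M"
    and "integrable M (\<lambda>\<omega>. norm (Y \<omega>) powr p)" "integrable M (\<lambda>\<omega>. norm (Z \<omega>) powr p)"
    by (elim radonifying_spaceE)
  then have "Lp_norm M p (\<lambda>\<omega>. Y \<omega> + Z \<omega>) \<le> Lp_norm M p Y + Lp_norm M p Z"
    by (intro Lp_norm_triangle_ineq p)
  moreover have ST: "represents (S + T) (\<lambda>\<omega>. Y \<omega> + Z \<omega>)"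
    using represents_linear_combination[OF YZ, of 1 1] by simp
  ultimately show "radonifying_norm \<theta> p (S + T) \<le> radonifying_norm \<theta> p S + radonifying_norm \<theta> p T"
    unfolding radonifying_norm_eq[OF YZ(1)] radonifying_norm_eq[OF YZ(2)] radonifying_norm_eq[OF ST]
    using norm_triangle_ineq[of S T] by simp
qed

text \<open>
  A Cauchy sequence has a limit \<open>L\<close> in operator norm, and its representatives have a limit \<open>Z\<close> in
  mean of order \<open>p\<close>.  Convergence of the representatives almost surely along a subsequence shows that
  \<open>Z\<close> represents \<open>L\<close>, which ties the two limits together.
\<close>

lemma radonifying_space_complete:
  fixes T :: "nat \<Rightarrow> 'h \<Rightarrow>\<^sub>L 'v::{banach, second_countable_topology}"
  assumes cont: "continuous_on UNIV (cyl_char \<theta>)" and p: "1 \<le> p"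
    and T: "\<And>n. T n \<in> radonifying_space \<theta> p"
    and Cauchy: "\<And>e. 0 < e \<Longrightarrow> \<exists>N. \<forall>m\<ge>N. \<forall>n\<ge>N. radonifying_norm \<theta> p (T m - T n) < e"
  shows "\<exists>L\<in>radonifying_space \<theta> p. (\<lambda>n. radonifying_norm \<theta> p (T n - L)) \<longlonglongrightarrow> 0"
proof -
  have "\<forall>n. \<exists>Y. represents (T n) Y \<and> integrable M (\<lambda>\<omega>. norm (Y \<omega>) powr p)"
    using T radonifying_space_iff by blast
  then obtain Y where Y: "\<And>n. represents (T n) (Y n)" "\<And>n. integrable M (\<lambda>\<omega>. norm (Y n \<omega>) powr p)"
    by metis
  have Y_meas: "Y n \<in> borel_measurable M" for n
    using Y(1) by (simp add: represents_def)
  have norm_diff: "radonifying_norm \<theta> p (T n - L) = Lp_norm M p (\<lambda>\<omega>. Y n \<omega> - Z \<omega>) + norm (T n - L)"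
    if "represents L Z" for n L Z
    using represents_linear_combination[OF Y(1)[of n] that, of 1 "- 1"] by (simp add: radonifying_norm_eq)
  have Cauchy_Y: "\<exists>N. \<forall>m\<ge>N. \<forall>n\<ge>N. Lp_norm M p (\<lambda>\<omega>. Y m \<omega> - Y n \<omega>) < e" if "0 < e" for e
    using Cauchy[OF that] unfolding norm_diff[OF Y(1)]
    by (meson add_increasing2 le_less_trans norm_ge_zero order_refl)
  have "Cauchy T"
  proof (rule metric_CauchyI)
    fix e :: real assume "0 < e"
    then show "\<exists>N. \<forall>m\<ge>N. \<forall>n\<ge>N. dist (T m) (T n) < e"
      using Cauchy[of e] unfolding norm_diff[OF Y(1)] dist_norm
      by (meson add_increasing le_less_trans Lp_norm_nonneg order_refl)
  qed
  then obtain L where L: "T \<longlonglongrightarrow> L"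
    using Cauchy_convergent convergent_def by blast
  obtain r Z where r: "strict_mono r" and Z: "Z \<in> borel_measurable M"
    and lim: "AE \<omega> in M. (\<lambda>k. Y (r k) \<omega>) \<longlonglongrightarrow> Z \<omega>"
    and Z_int: "integrable M (\<lambda>\<omega>. norm (Z \<omega>) powr p)"
    and Lp_lim: "(\<lambda>n. Lp_norm M p (\<lambda>\<omega>. Y n \<omega> - Z \<omega>)) \<longlonglongrightarrow> 0"
    using Lp_Cauchy_convergent[OF p Y_meas Y(2) Cauchy_Y] by blast
  have "(\<lambda>k. T (r k)) \<longlonglongrightarrow> L"
    using LIMSEQ_subseq_LIMSEQ[OF L r] by (simp add: comp_def)
  then have LZ: "represents L Z"
    using Y(1) Z lim by (rule represents_limit[OF cont])
  then have "L \<in> radonifying_space \<theta> p"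
    using Z_int radonifying_space_iff by blast
  moreover have "(\<lambda>n. radonifying_norm \<theta> p (T n - L)) \<longlonglongrightarrow> 0"
    unfolding norm_diff[OF LZ]
    using tendsto_add[OF Lp_lim tendsto_norm[OF LIM_zero[OF L]]] by simp
  ultimately show ?thesis by blast
qed

end

theorem theorem4p1:
  fixes \<theta> :: "'h::{real_inner, banach, second_countable_topology} set \<Rightarrow> ennreal"
    and p :: real
  assumes "cylindrical_prob \<theta>"
    and "continuous_on UNIV (cyl_char \<theta>)"
    and "p \<ge> 1"
  shows "banach_space_on
           (radonifying_space \<theta> p :: ('h \<Rightarrow>\<^sub>L 'v::{banach, second_countable_topology}) set)
           (radonifying_norm \<theta> p)"
proof -
  obtain M :: "(('h \<Rightarrow>\<^sub>L real) \<Rightarrow> real) measure" where "cylindrical_process M \<theta> (\<lambda>w \<omega>. \<omega> w)"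
    using exists_cylindrical_process[OF assms(1)] by blast
  then interpret cylindrical_process M \<theta> "\<lambda>w \<omega>. \<omega> w" .
  show ?thesis
    unfolding banach_space_on_def
    using subspace_radonifying_space[OF assms(3)] norm_on_radonifying_space[OF assms(3)]
      radonifying_space_complete[OF assms(2,3)] by blast
qed

end
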